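(* Let $m,n\in\mathbb N_0$, let $q\in\mathbb C$ with $0<|q|<1$, and let $\alpha,a,b,c\in\mathbb C\setminus\{0\}$ be such that $(-q\alpha t;q)_\infty\neq 0$ and $(qt/\alpha;q)_\infty\ne 0$ for every $t\in\{a,b,c\}$. Then the continuous dual $q^{-1}$-Hahn polynomials $\mathsf p_n[z;a,b,c|q]$ satisfy $$\sum_{k=-\infty}^\infty (1+q^{2k}\alpha^2)\,\mathsf p_m[q^k\alpha;a,b,c|q]\,\mathsf p_n[q^k\alpha;a,b,c|q]\,\frac{(\frac{\alpha}{a},\frac{\alpha}{b},\frac{\alpha}{c};q)_k}{(-q\alpha a,-q\alpha b,-q\alpha c;q)_k}\,q^{\binom k2}(-q\alpha abc)^k$$ $$=\frac{(q,-\alpha^2,-\frac{q}{\alpha^2},-qab,-qac,-qbc;q)_\infty}{(-q\alpha a,-q\alpha b,-q\alpha c,\frac{qa}{\alpha},\frac{qb}{\alpha},\frac{qc}{\alpha};q)_\infty}\,q^{-4\binom n2}\left(\frac{a^2b^2c^2}{q}\right)^n\Big(q,-\frac1{ab},-\frac1{ac},-\frac1{bc};q\Big)_n\,\delta_{m,n}.$$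
   Context: Notation: $\mathbb N_0=\{0,1,2,\dots\}$. For $n\in\mathbb N_0$, $(y;q)_n=\prod_{j=0}^{n-1}(1-yq^j)$, $(y;q)_\infty=\prod_{j\ge0}(1-yq^j)$; for negative indices, $(y;q)_{-j}=1/(yq^{-j};q)_j$ (so $1/(y;q)_{-j}=(yq^{-j};q)_j$), $j\in\mathbb N$. Products: $(y_1,\dots,y_r;q)_k=\prod_i(y_i;q)_k$, also for $k=\infty$. $\binom k2=k(k-1)/2$ for all $k\in\mathbb Z$. $\delta_{m,n}$ is the Kronecker delta. The continuous dual $q^{-1}$-Hahn polynomials are polynomials of degree $n$ in $x=\frac12(z-z^{-1})$, defined by $\mathsf p_n[z;a,b,c|q]=i^{-n}p_n[iz;ia,ib,ic|q^{-1}]$, where $p_n$ is the continuous dual $q$-Hahn polynomial in standard normalization, written as a function of $w$ with argument $\frac12(w+w^{-1})$. Explicitly, $$\mathsf p_n[z;a,b,c|q]=q^{-2\binom n2}(-abc)^n\sum_{k=0}^n\frac{(q^{-n},\frac za,-\frac1{az};q)_k}{(q;q)_k}\Big(-\frac{q^n}{bc}\Big)^k\Big(-\frac{q^k}{ab},-\frac{q^k}{ac};q\Big)_{n-k}.$$ *)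

theory Defs
  imports "HOL-Analysis.Analysis"
begin

definition qpoch :: "complex \<Rightarrow> complex \<Rightarrow> nat \<Rightarrow> complex" where
  "qpoch y q n = (\<Prod>j<n. 1 - y * q ^ j)"

(* If (y q^k; q)_{-k} = 0 for some k < 0, then (y; q)_k is infinite and only
   1/(y; q)_k = (y q^k; q)_{-k} = 0 is meaningful.  As 1/0 = 0, the reciprocal of
   qpoch_int has exactly this value; see qpoch_int_reciprocal. *)
definition qpoch_int :: "complex \<Rightarrow> complex \<Rightarrow> int \<Rightarrow> complex" where
  "qpoch_int y q k =
     (if k \<ge> 0 then qpoch y q (nat k) else 1 / qpoch (y * q powi k) q (nat (- k)))"

(* Meaningful for norm q < 1, where the product converges (vanishing factors are allowed). *)
definition qpoch_inf :: "complex \<Rightarrow> complex \<Rightarrow> complex" where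
  "qpoch_inf y q = (\<Prod>j. 1 - y * q ^ j)"

lemma qpoch_int_reciprocal:
  "1 / qpoch_int y q (- int j) = qpoch (y * q powi (- int j)) q j"
  by (cases "j = 0") (auto simp: qpoch_int_def qpoch_def)

(* The continuous dual q-Hahn polynomial p_n(x; a, b, c | q), x = (w + 1/w)/2, in standard
   normalization (ab, ac; q)_n a^(-n) 3phi2(q^(-n), a w, a/w; ab, ac; q, q).  The quotients
   (ab; q)_n / (ab; q)_k are written as (ab q^k; q)_{n-k}, so that the definition is also
   correct when (ab; q)_n or (ac; q)_n vanishes; see cdqHahn_standard. *)
definition cdqHahn ::
    "nat \<Rightarrow> complex \<Rightarrow> complex \<Rightarrow> complex \<Rightarrow> complex \<Rightarrow> complex \<Rightarrow> complex" where
  "cdqHahn n w a b c q =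
     (\<Sum>k\<le>n. (\<Prod>y\<leftarrow>[q powi (- int n), a * w, a / w]. qpoch y q k) / qpoch q q k * q ^ k *
            (\<Prod>y\<leftarrow>[a * b * q ^ k, a * c * q ^ k]. qpoch y q (n - k))) / a ^ n"

definition cdqinvHahn ::
    "nat \<Rightarrow> complex \<Rightarrow> complex \<Rightarrow> complex \<Rightarrow> complex \<Rightarrow> complex \<Rightarrow> complex" where
  "cdqinvHahn n z a b c q =
     \<i> powi (- int n) * cdqHahn n (\<i> * z) (\<i> * a) (\<i> * b) (\<i> * c) (1 / q)"

lemma qpoch_add: "qpoch y q (k + m) = qpoch y q k * qpoch (y * q ^ k) q m"
  by (induction m) (simp_all add: qpoch_def power_add mult.assoc)

lemma cdqHahn_standard:
  assumes "qpoch (a * b) q n \<noteq> 0" "qpoch (a * c) q n \<noteq> 0"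
  shows "cdqHahn n w a b c q =
    qpoch (a * b) q n * qpoch (a * c) q n / a ^ n *
    (\<Sum>k\<le>n. qpoch (q powi (- int n)) q k * qpoch (a * w) q k * qpoch (a / w) q k /
       (qpoch (a * b) q k * qpoch (a * c) q k * qpoch q q k) * q ^ k)"
proof -
  have split: "qpoch y q n = qpoch y q k * qpoch (y * q ^ k) q (n - k)" if "k \<le> n" for y k
    using qpoch_add[of y q k "n - k"] that by simp
  have "(\<Prod>y\<leftarrow>[q powi (- int n), a * w, a / w]. qpoch y q k) / qpoch q q k * q ^ k *
            (\<Prod>y\<leftarrow>[a * b * q ^ k, a * c * q ^ k]. qpoch y q (n - k)) =
        qpoch (a * b) q n * qpoch (a * c) q n *
        (qpoch (q powi (- int n)) q k * qpoch (a * w) q k * qpoch (a / w) q k /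
          (qpoch (a * b) q k * qpoch (a * c) q k * qpoch q q k) * q ^ k)" if "k \<le> n" for k
    using assms split[OF that, of "a * b"] split[OF that, of "a * c"] by simp
  hence "(\<Sum>k\<le>n. (\<Prod>y\<leftarrow>[q powi (- int n), a * w, a / w]. qpoch y q k) / qpoch q q k * q ^ k *
            (\<Prod>y\<leftarrow>[a * b * q ^ k, a * c * q ^ k]. qpoch y q (n - k))) =
        qpoch (a * b) q n * qpoch (a * c) q n *
        (\<Sum>k\<le>n. qpoch (q powi (- int n)) q k * qpoch (a * w) q k * qpoch (a / w) q k /
          (qpoch (a * b) q k * qpoch (a * c) q k * qpoch q q k) * q ^ k)"
    unfolding sum_distrib_left by (intro sum.cong) auto
  thus ?thesis
    unfolding cdqHahn_def by simp
qed

lemma qpoch_inverse_base: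
  assumes "y \<noteq> 0" "q \<noteq> 0"
  shows "qpoch y (1 / q) k = qpoch (1 / y) q k * (- y) ^ k / q ^ (k choose 2)"
proof (induction k)
  case 0
  show ?case by (simp add: qpoch_def numeral_2_eq_2)
next
  case (Suc k)
  have C: "Suc k choose 2 = k + (k choose 2)"
    by (simp add: numeral_2_eq_2)
  have "1 - y * (1 / q) ^ k = (1 - 1 / y * q ^ k) * (- y) / q ^ k"
    using assms by (simp add: field_simps)
  with Suc show ?case
    unfolding C by (simp add: qpoch_def power_add mult_ac)
qed

lemma choose_2_add: "(k + m) choose 2 = (k choose 2) + (m choose 2) + k * m"
  by (induction m) (simp_all add: numeral_2_eq_2)

lemma cdqinvHahn_explicit:
  assumes "q \<noteq> 0" "z \<noteq> 0" "a \<noteq> 0" "b \<noteq> 0" "c \<noteq> 0"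
  shows "cdqinvHahn n z a b c q =
    q powi (- 2 * int (n choose 2)) * (- (a * b * c)) ^ n *
    (\<Sum>k\<le>n. (\<Prod>y\<leftarrow>[q powi (- int n), z / a, - 1 / (a * z)]. qpoch y q k) / qpoch q q k *
       (- (q ^ n) / (b * c)) ^ k *
       (\<Prod>y\<leftarrow>[- (q ^ k) / (a * b), - (q ^ k) / (a * c)]. qpoch y q (n - k)))"
    (is "_ = ?P * ?N * (\<Sum>k\<le>n. ?R k)")
proof -
  let ?L = "\<lambda>k. (\<Prod>y\<leftarrow>[(1 / q) powi (- int n), \<i> * a * (\<i> * z), \<i> * a / (\<i> * z)]. qpoch y (1 / q) k) /
      qpoch (1 / q) (1 / q) k * (1 / q) ^ k *
      (\<Prod>y\<leftarrow>[\<i> * a * (\<i> * b) * (1 / q) ^ k, \<i> * a * (\<i> * c) * (1 / q) ^ k]. qpoch y (1 / q) (n - k))"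
  have ii: "\<i> * x * (\<i> * y) = - (x * y)" for x y
  proof -
    have "\<i> * x * (\<i> * y) = (\<i> * \<i>) * (x * y)" by (simp only: mult_ac)
    thus ?thesis by simp
  qed
  have P: "\<i> powi (- int n) / (\<i> * a) ^ n = (- 1) ^ n / a ^ n"
    using power_minus[of a n] minus_one_mult_self[of n]
    by (simp add: power_int_minus divide_simps flip: power_mult_distrib)
  have "?L k * ((- 1) ^ n / a ^ n) = ?P * ?N * ?R k" if "k \<le> n" for k
  proof -
    obtain m where n: "n = k + m" using \<open>k \<le> n\<close> le_Suc_ex by blast
    hence nm: "n - k = m" by simp
    define C D where "C = k choose 2" and "D = m choose 2"
    define X1 X2 X3 X4 X5 X6 where
      "X1 = qpoch (1 / q ^ n) q k" and "X2 = qpoch (- 1 / (a * z)) q k" and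
      "X3 = qpoch (z / a) q k" and "X4 = qpoch q q k" and
      "X5 = qpoch (- (q ^ k) / (a * b)) q m" and "X6 = qpoch (- (q ^ k) / (a * c)) q m"
    have inv: "qpoch u (1 / q) l = qpoch v q l * (- u) ^ l / q ^ (l choose 2)"
      if "u \<noteq> 0" "v = 1 / u" for u v l
      unfolding that(2) by (rule qpoch_inverse_base[OF that(1) assms(1)])
    have X56: "qpoch (\<i> * a * (\<i> * d) * (1 / q) ^ k) (1 / q) m =
        qpoch (- (q ^ k) / (a * d)) q m * (a * d / q ^ k) ^ m / q ^ D" if "d \<noteq> 0" for d
    proof -
      have u: "\<i> * a * (\<i> * d) * (1 / q) ^ k = - (a * d / q ^ k)"
        by (simp add: ii power_one_over)
      have "qpoch (- (a * d / q ^ k)) (1 / q) m =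
          qpoch (- (q ^ k) / (a * d)) q m * (- (- (a * d / q ^ k))) ^ m / q ^ D"
        unfolding D_def by (rule inv) (use assms that in \<open>simp_all add: divide_simps\<close>)
      thus ?thesis unfolding u by simp
    qed
    have "qpoch ((1 / q) powi (- int n)) (1 / q) k = X1 * (- (q ^ n)) ^ k / q ^ C"
    proof -
      have "(1 / q) powi (- int n) = q ^ n"
        by (simp add: power_int_minus power_one_over)
      thus ?thesis
        unfolding X1_def C_def using assms by (simp add: inv)
    qed
    moreover have "qpoch (\<i> * a * (\<i> * z)) (1 / q) k = X2 * (a * z) ^ k / q ^ C"
    proof -
      have u: "\<i> * a * (\<i> * z) = - (a * z)"
        by (rule ii)
      have "qpoch (- (a * z)) (1 / q) k = X2 * (- (- (a * z))) ^ k / q ^ C"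
        unfolding X2_def C_def by (rule inv) (use assms in \<open>simp_all add: divide_simps\<close>)
      thus ?thesis unfolding u by simp
    qed
    moreover have "qpoch (\<i> * a / (\<i> * z)) (1 / q) k = X3 * (- (a / z)) ^ k / q ^ C"
    proof -
      have u: "\<i> * a / (\<i> * z) = a / z" by simp
      show ?thesis
        unfolding u X3_def C_def by (rule inv) (use assms in simp_all)
    qed
    moreover have "qpoch (1 / q) (1 / q) k = X4 * (- (1 / q)) ^ k / q ^ C"
      unfolding X4_def C_def by (rule inv) (use assms in simp_all)
    moreover note X56[OF assms(4), folded X5_def] X56[OF assms(5), folded X6_def]
    ultimately have L: "?L k =
        (X1 * (- (q ^ n)) ^ k / q ^ C) * (X2 * (a * z) ^ k / q ^ C) * (X3 * (- (a / z)) ^ k / q ^ C) /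
        (X4 * (- (1 / q)) ^ k / q ^ C) * (1 / q) ^ k *
        ((X5 * (a * b / q ^ k) ^ m / q ^ D) * (X6 * (a * c / q ^ k) ^ m / q ^ D))"
      by (simp only: nm list.map prod_list.Cons prod_list.Nil mult_1_right mult.assoc)
    have R: "?R k = X1 * X3 * X2 / X4 * (- (q ^ n) / (b * c)) ^ k * (X5 * X6)"
    proof -
      have "q powi (- int n) = 1 / q ^ n" by (simp add: power_int_minus inverse_eq_divide)
      thus ?thesis
        unfolding X1_def X2_def X3_def X4_def X5_def X6_def nm by simp
    qed
    have PP: "?P = 1 / (q ^ C * q ^ D * q ^ (k * m))\<^sup>2"
    proof -
      have "n choose 2 = C + D + k * m" by (simp add: n C_def D_def choose_2_add)
      hence "- 2 * int (n choose 2) = - int ((C + D + k * m) * 2)" by simp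
      hence "?P = 1 / q ^ ((C + D + k * m) * 2)"
        by (simp only: power_int_minus power_int_of_nat inverse_eq_divide)
      hence "?P = 1 / (q ^ (C + D + k * m))\<^sup>2"
        by (simp only: power_mult)
      thus ?thesis by (simp add: power_add)
    qed
    have sg: "(- (q ^ n)) ^ k = (-1) ^ k * (q ^ n) ^ k" "(- (a / z)) ^ k = (-1) ^ k * a ^ k / z ^ k"
      "(- (1 / q)) ^ k = (-1) ^ k / q ^ k" "(- (q ^ n) / (b * c)) ^ k = (-1) ^ k * (q ^ n) ^ k / (b ^ k * c ^ k)"
      "(- (a * b * c)) ^ n = (-1) ^ n * a ^ n * b ^ n * c ^ n"
      "(a * b / q ^ k) ^ m = a ^ m * b ^ m / q ^ (k * m)" "(a * c / q ^ k) ^ m = a ^ m * c ^ m / q ^ (k * m)"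
      "(a * z) ^ k = a ^ k * z ^ k" "(1 / q) ^ k = 1 / q ^ k"
      using power_minus[of "q ^ n" k] power_minus[of "a / z" k] power_minus[of "1 / q" k]
        power_minus[of "q ^ n / (b * c)" k] power_minus[of "a * b * c" n]
      by (simp_all add: power_mult_distrib power_divide power_mult)
    show ?thesis
    proof (cases "X4 = 0")
      case True
      thus ?thesis unfolding L R by simp
    next
      case False
      have pn: "a ^ n = a ^ k * a ^ m" "b ^ n = b ^ k * b ^ m" "c ^ n = c ^ k * c ^ m"
        by (simp_all add: n power_add)
      define e where "e = (-1 :: complex) ^ k"
      have e: "e \<noteq> 0" by (simp add: e_def)
      show ?thesis
        unfolding L R PP
        unfolding sg pn e_def[symmetric]
        using assms False e by (simp add: divide_simps power2_eq_square)
    qed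
  qed
  hence "(\<Sum>k\<le>n. ?L k * ((- 1) ^ n / a ^ n)) = (\<Sum>k\<le>n. ?P * ?N * ?R k)"
    by (intro sum.cong) auto
  moreover have "cdqinvHahn n z a b c q = (\<Sum>k\<le>n. ?L k) * (\<i> powi (- int n) / (\<i> * a) ^ n)"
    by (simp add: cdqinvHahn_def cdqHahn_def)
  ultimately show ?thesis
    unfolding P by (simp only: sum_distrib_left sum_distrib_right)
qed

end

theory Submission
  imports Defs
begin

text \<open>
Put z = q^k \<alpha> and x = z - 1/z, and let P_t(z) = (-qtz, qt/z; q)_\<infinity>. When the nonzero infinite
products in the denominators are cleared, the summand becomes W p_m p_n with
W = (1 + z^2) q^(2k^2-k) \<alpha>^(4k) P_a P_b P_c, which is entire in a, b, c
(\<open>qpoch_int_quotient\<close>, \<open>theta_weight_eq\<close>). It converges like a Gaussian in k.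

The sum S(a, b, c) of W alone has a closed form. Since P_(t/q) = (1 - t^2 + t x) P_t, dividing a
parameter by q inserts a linear polynomial in x, and a summation by parts shows that x may be
replaced by a + b + c + abc under the sum (\<open>W_telescopes\<close>). Hence
S(a/q, b, c) = (1 + ab)(1 + ac) S(a, b, c). Iterating this towards smaller parameters, in all three of them, and
passing to the limit by dominated convergence gives
S(a, b, c) = (-qab, -qac, -qbc; q)_\<infinity> S(0, 0, 0) (\<open>S_eq_S_0\<close>), and the constant
(q, -\<alpha>^2, -q/\<alpha>^2; q)_\<infinity> can be read off at a = \<alpha>, b = -1/\<alpha>, where only the term k = 0
survives (\<open>S_0\<close>). This is a limiting case of Bailey's bilateral 6-psi-6 sum.

The polynomials enter through phi_k^t = (z/t, -1/(tz); q)_k, a polynomial of degree k in x for which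
phi_k^t P_t is a multiple of P_(t/q^k). So the sum of W phi_i^a phi_l^b is again a value of S, hence an
explicit product (\<open>L_phi_phi\<close>). The definition expands p_n in the phi_k^a; summed against
phi_l^b, it becomes an n-th q-difference of a polynomial of degree l, which vanishes for l < n and is
explicit for l = n by the q-binomial theorem (\<open>L_hahn_phi\<close>). Thus p_n is orthogonal to all
polynomials in x of smaller degree. As p_m is monic in x, the case m = n follows by comparing the
leading coefficients of p_n and phi_n^b (\<open>L_hahn_hahn\<close>).
\<close>

section \<open>q-shifted factorials and Euler products\<close>

lemma qpoch_0 [simp]: "qpoch y q 0 = 1"
  by (simp add: qpoch_def)

lemma qpoch_Suc: "qpoch y q (Suc n) = qpoch y q n * (1 - y * q ^ n)"
  by (simp add: qpoch_def)

lemma qpoch_inf_convergent_prod: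
  fixes q y :: complex
  assumes "norm q < 1"
  shows "convergent_prod (\<lambda>j. 1 - y * q ^ j)"
proof -
  have eq: "norm (1 - y * q ^ j - 1) = norm y * norm q ^ j" for j
    by (simp add: norm_mult norm_power)
  have "summable (\<lambda>j. norm (1 - y * q ^ j - 1))"
    unfolding eq using assms by (intro summable_mult summable_geometric) simp
  thus ?thesis
    by (intro abs_convergent_prod_imp_convergent_prod summable_imp_abs_convergent_prod)
qed

lemma qpoch_tendsto_qpoch_inf:
  assumes "norm q < 1"
  shows "(\<lambda>n. qpoch y q n) \<longlonglongrightarrow> qpoch_inf y q"
proof -
  have "(\<lambda>n. qpoch y q (Suc n)) \<longlonglongrightarrow> qpoch_inf y q"
    using convergent_prod_LIMSEQ[OF qpoch_inf_convergent_prod[OF assms, of y]]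
    by (simp add: qpoch_def qpoch_inf_def lessThan_Suc_atMost)
  thus ?thesis by (rule LIMSEQ_imp_Suc)
qed

lemma qpoch_inf_split:
  assumes "norm q < 1"
  shows "qpoch_inf y q = qpoch y q n * qpoch_inf (y * q ^ n) q"
proof (rule LIMSEQ_unique)
  show "(\<lambda>m. qpoch y q (n + m)) \<longlonglongrightarrow> qpoch_inf y q"
    using LIMSEQ_ignore_initial_segment[OF qpoch_tendsto_qpoch_inf[OF assms, of y], of n]
    by (simp add: add.commute)
  show "(\<lambda>m. qpoch y q (n + m)) \<longlonglongrightarrow> qpoch y q n * qpoch_inf (y * q ^ n) q"
    unfolding qpoch_add by (intro tendsto_intros qpoch_tendsto_qpoch_inf assms)
qed

lemma qpoch_inf_step:
  assumes "norm q < 1"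
  shows "qpoch_inf y q = (1 - y) * qpoch_inf (y * q) q"
  using qpoch_inf_split[OF assms, of y 1] by (simp add: qpoch_def)

lemma qpoch_inf_zero [simp]: "qpoch_inf 0 q = 1"
  by (simp add: qpoch_inf_def)

lemma qpoch_inf_eq_0:
  assumes "norm q < 1" "y * q ^ j = 1"
  shows "qpoch_inf y q = 0"
  using qpoch_inf_split[OF assms(1), of y "Suc j"] assms(2) by (simp add: qpoch_Suc)

lemma qpoch_inf_nonzero:
  assumes "norm q < 1" "norm y < 1"
  shows "qpoch_inf y q \<noteq> 0"
  unfolding qpoch_inf_def
proof (rule prodinf_nonzero)
  show "convergent_prod (\<lambda>j. 1 - y * q ^ j)"
    by (rule qpoch_inf_convergent_prod[OF assms(1)])
  fix j
  have "norm (y * q ^ j) \<le> norm y * 1"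
    unfolding norm_mult norm_power using assms by (intro mult_left_mono power_le_one) auto
  with assms(2) show "1 - y * q ^ j \<noteq> 0" by auto
qed

lemma qpoch_inf_tendsto_1:
  assumes "norm q < 1"
  shows "(\<lambda>n. qpoch_inf (y * q ^ n) q) \<longlonglongrightarrow> 1"
proof -
  have "(\<lambda>n. y * q ^ n) \<longlonglongrightarrow> y * 0"
    using assms by (intro tendsto_intros LIMSEQ_power_zero)
  hence "eventually (\<lambda>n. norm (y * q ^ n) < 1) sequentially"
    using order_tendstoD(2)[OF tendsto_norm, of "\<lambda>n. y * q ^ n" 0 sequentially 1] by simp
  then obtain N where N: "norm (y * q ^ N) < 1"
    by (auto simp: eventually_sequentially)
  \<comment> \<open>Beyond N no factor vanishes, so the tail products are quotients by nonzero partial products.\<close>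
  define w where "w = y * q ^ N"
  have w: "qpoch_inf w q \<noteq> 0"
    unfolding w_def by (rule qpoch_inf_nonzero[OF assms N])
  have nz: "qpoch w q n \<noteq> 0" for n
    using qpoch_inf_split[OF assms, of w n] w by auto
  have "(\<lambda>n. qpoch_inf w q / qpoch w q n) \<longlonglongrightarrow> qpoch_inf w q / qpoch_inf w q"
    by (intro tendsto_intros qpoch_tendsto_qpoch_inf assms w)
  moreover have "qpoch_inf w q / qpoch w q n = qpoch_inf (y * q ^ (n + N)) q" for n
    using qpoch_inf_split[OF assms, of w n] nz[of n] by (simp add: w_def power_add mult_ac)
  ultimately have "(\<lambda>n. qpoch_inf (y * q ^ (n + N)) q) \<longlonglongrightarrow> 1"
    using w by simp
  thus ?thesis by (rule LIMSEQ_offset)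
qed

lemma norm_qpoch_inf_le:
  assumes "norm q < 1" "norm y \<le> x"
  shows "norm (qpoch_inf y q) \<le> norm (qpoch_inf (- of_real x) (of_real (norm q)))"
proof (rule LIMSEQ_le)
  show "(\<lambda>n. norm (qpoch y q n)) \<longlonglongrightarrow> norm (qpoch_inf y q)"
    by (intro tendsto_norm qpoch_tendsto_qpoch_inf assms)
  show "(\<lambda>n. norm (qpoch (- of_real x) (of_real (norm q)) n))
      \<longlonglongrightarrow> norm (qpoch_inf (- of_real x) (of_real (norm q)))"
    by (intro tendsto_norm qpoch_tendsto_qpoch_inf) (use assms in simp)
  have "norm (1 - y * q ^ j) \<le> norm (1 - - complex_of_real x * complex_of_real (norm q) ^ j)" for j
  proof -
    have "norm (1 - y * q ^ j) \<le> 1 + norm y * norm q ^ j"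
      by (rule order_trans[OF norm_triangle_ineq4]) (simp add: norm_mult norm_power)
    also have "\<dots> \<le> 1 + x * norm q ^ j"
      using assms by (intro add_left_mono mult_right_mono) auto
    also have "\<dots> \<le> norm (complex_of_real (1 + x * norm q ^ j))"
      unfolding norm_of_real by simp
    finally show ?thesis by simp
  qed
  thus "\<exists>N. \<forall>n\<ge>N. norm (qpoch y q n) \<le> norm (qpoch (- of_real x) (of_real (norm q)) n)"
    unfolding qpoch_def prod_norm[symmetric] by (intro exI allI impI prod_mono) auto
qed

text \<open>Each of the k new factors 1 - s / q^j is rewritten as - s / q^j times 1 - q^j / s, which turns a
shift of the parameter towards infinity into a finite product in the inverse parameter.\<close>

lemma qpoch_inf_backward:
  assumes "q \<noteq> 0" "norm q < 1" "s \<noteq> 0"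
  shows "qpoch_inf (q * s / q ^ k) q = (- s) ^ k / q ^ (k choose 2) * qpoch (1 / s) q k * qpoch_inf (q * s) q"
proof (induction k)
  case 0
  show ?case by (simp add: numeral_2_eq_2)
next
  case (Suc k)
  have C: "Suc k choose 2 = k + (k choose 2)"
    by (simp add: numeral_2_eq_2)
  have "qpoch_inf (q * s / q ^ Suc k) q = (1 - s / q ^ k) * qpoch_inf (q * s / q ^ k) q"
    using qpoch_inf_step[OF assms(2), of "q * s / q ^ Suc k"] assms by (simp add: mult_ac)
  also have "1 - s / q ^ k = - s / q ^ k * (1 - 1 / s * q ^ k)"
    using assms by (simp add: field_simps)
  finally show ?case
    unfolding Suc.IH C qpoch_Suc using assms by (simp add: power_add field_simps)
qed

lemma qpoch_self_inverse_power:
  assumes "q \<noteq> 0"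
  shows "qpoch (1 / q ^ n) q n = (- 1) ^ n / (q ^ n * q ^ (n choose 2)) * qpoch q q n"
proof -
  have shift: "q * q ^ (n - Suc i) = q ^ n / q ^ i" if "i < n" for i
  proof -
    have "Suc (n - Suc i) = n - i" using that by simp
    thus ?thesis using that assms by (metis power_Suc power_diff less_imp_le)
  qed
  have "qpoch (1 / q ^ n) q n = (\<Prod>j<n. - (1 - q * q ^ j) / (q * q ^ j))"
    unfolding qpoch_def
  proof (rule prod.reindex_bij_witness[where i = "\<lambda>j. n - Suc j" and j = "\<lambda>j. n - Suc j"])
    fix i assume "i \<in> {..<n}"
    hence "i < n" by simp
    show "- (1 - q * q ^ (n - Suc i)) / (q * q ^ (n - Suc i)) = 1 - 1 / q ^ n * q ^ i"
      unfolding shift[OF \<open>i < n\<close>] using assms by (simp add: divide_simps)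
  qed auto
  also have "\<dots> = (- 1) ^ n / (q ^ n * q ^ (n choose 2)) * qpoch q q n"
  proof (induction n)
    case 0
    show ?case by (simp add: numeral_2_eq_2)
  next
    case (Suc n)
    have C: "Suc n choose 2 = n + (n choose 2)"
      by (simp add: numeral_2_eq_2)
    show ?case
      unfolding prod.lessThan_Suc Suc.IH qpoch_Suc C using assms by (simp add: power_add field_simps)
  qed
  finally show ?thesis .
qed

section \<open>The finite q-binomial theorem and linear functionals on polynomials\<close>

text \<open>In the form g n k = (\<Prod>i<k. (q^n - q^i) / (1 - q^(i+1))) the coefficients satisfy a q-Pascal
rule, which is exactly multiplication of (x; q)_n by its next factor 1 - x q^n.\<close>

lemma q_binomial_theorem:
  assumes q: "q \<noteq> 0" "\<And>i. 0 < i \<Longrightarrow> q ^ i \<noteq> 1"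
  shows "(\<Sum>k\<le>n. qpoch (1 / q ^ n) q k / qpoch q q k * (q ^ n * x) ^ k) = qpoch x q n"
proof -
  define g where "g n k = (\<Prod>i<k. (q ^ n - q ^ i) / (1 - q ^ Suc i))" for n k
  have g: "qpoch (1 / q ^ n) q k / qpoch q q k * (q ^ n * x) ^ k = g n k * x ^ k" for n k
  proof -
    have "g n k = (\<Prod>i<k. (1 - 1 / q ^ n * q ^ i) / (1 - q * q ^ i) * q ^ n)"
    proof (unfold g_def, intro prod.cong refl)
      fix i
      have "q ^ n - q ^ i = (1 - 1 / q ^ n * q ^ i) * q ^ n"
        using q(1) by (simp add: algebra_simps)
      thus "(q ^ n - q ^ i) / (1 - q ^ Suc i) = (1 - 1 / q ^ n * q ^ i) / (1 - q * q ^ i) * q ^ n"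
        by simp
    qed
    also have "\<dots> = qpoch (1 / q ^ n) q k / qpoch q q k * (q ^ n) ^ k"
      by (simp add: prod.distrib prod_dividef qpoch_def)
    finally show ?thesis by (simp add: power_mult_distrib)
  qed
  have g0 [simp]: "g n 0 = 1" for n by (simp add: g_def)
  have gz: "g n k = 0" if "n < k" for n k
    unfolding g_def using that by (intro prod_zero) auto
  have rec: "g (Suc n) (Suc k) = g n (Suc k) - q ^ n * g n k" for n k
  proof -
    have D: "(\<Prod>i<m. 1 - q ^ Suc i) \<noteq> 0" for m
      using q(2) by (simp del: power_Suc)
    have nz: "1 - q * q ^ k \<noteq> 0"
      using q(2)[of "Suc k"] by auto
    have N: "(\<Prod>i<Suc k. q ^ Suc n - q ^ i) = (q ^ Suc n - 1) * q ^ k * (\<Prod>i<k. q ^ n - q ^ i)"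
    proof -
      have "(\<Prod>i<k. q ^ Suc n - q ^ Suc i) = (\<Prod>i<k. q * (q ^ n - q ^ i))"
        by (simp add: algebra_simps)
      also have "\<dots> = q ^ k * (\<Prod>i<k. q ^ n - q ^ i)"
        by (simp only: prod.distrib prod_constant card_lessThan)
      finally show ?thesis
        unfolding prod.lessThan_Suc_shift by (simp add: mult_ac)
    qed
    define A B where "A = (\<Prod>i<k. q ^ n - q ^ i)" and "B = (\<Prod>i<k. 1 - q ^ Suc i)"
    have B: "B \<noteq> 0" unfolding B_def by (rule D)
    have "g (Suc n) (Suc k) = (q ^ Suc n - 1) * q ^ k * A / (B * (1 - q ^ Suc k))"
      unfolding g_def prod_dividef N A_def B_def by simp
    moreover have "g n (Suc k) = A / B * ((q ^ n - q ^ k) / (1 - q ^ Suc k))"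
      unfolding g_def A_def B_def by (simp add: prod_dividef)
    moreover have "g n k = A / B"
      unfolding g_def A_def B_def by (simp add: prod_dividef)
    moreover have "(q ^ Suc n - 1) * q ^ k * A / (B * (1 - q ^ Suc k)) =
        A / B * ((q ^ n - q ^ k) / (1 - q ^ Suc k)) - q ^ n * (A / B)"
      using B nz by (simp add: divide_simps) (simp add: algebra_simps)
    ultimately show ?thesis
      by (simp only:)
  qed
  have "(\<Sum>k\<le>n. g n k * x ^ k) = qpoch x q n"
  proof (induction n)
    case 0
    show ?case by simp
  next
    case (Suc n)
    have "(\<Sum>k\<le>Suc n. g (Suc n) k * x ^ k) = 1 + (\<Sum>k\<le>n. g (Suc n) (Suc k) * x ^ Suc k)"
      by (subst sum.atMost_Suc_shift) simp
    also have "\<dots> = (1 + (\<Sum>k\<le>n. g n (Suc k) * x ^ Suc k)) - q ^ n * x * (\<Sum>k\<le>n. g n k * x ^ k)"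
      unfolding rec by (simp add: algebra_simps sum_subtractf sum_distrib_left)
    also have "1 + (\<Sum>k\<le>n. g n (Suc k) * x ^ Suc k) = (\<Sum>k\<le>Suc n. g n k * x ^ k)"
      by (subst sum.atMost_Suc_shift) simp
    also have "\<dots> = (\<Sum>k\<le>n. g n k * x ^ k)"
      by (simp add: gz)
    finally show ?case
      unfolding Suc.IH qpoch_Suc by (simp add: algebra_simps)
  qed
  thus ?thesis unfolding g .
qed

text \<open>Subtracting from p the multiple of B n with the same leading coefficient leaves a polynomial of
degree below n, and the functional vanishes there because B 0, ..., B (n-1) span that space. This is
used twice: for the q-difference operator and for the orthogonality functional.\<close>

lemma linear_functional_leading_coeff:
  fixes \<Lambda> :: "complex poly \<Rightarrow> complex" and B :: "nat \<Rightarrow> complex poly"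
  assumes add: "\<And>p r. \<Lambda> (p + r) = \<Lambda> p + \<Lambda> r" and smult: "\<And>c p. \<Lambda> (smult c p) = c * \<Lambda> p"
    and deg: "\<And>j. degree (B j) = j" and nz: "\<And>j. B j \<noteq> 0"
    and zero: "\<And>j. j < n \<Longrightarrow> \<Lambda> (B j) = 0"
    and p: "degree p \<le> n"
  shows "\<Lambda> p = coeff p n / coeff (B n) n * \<Lambda> (B n)"
proof -
  have zero0: "\<Lambda> 0 = 0" using smult[of 0 0] by simp
  have lc: "coeff (B j) j \<noteq> 0" for j
    using nz[of j] deg[of j] by (metis leading_coeff_0_iff)
  have split: "\<Lambda> p = coeff p d / coeff (B d) d * \<Lambda> (B d) + \<Lambda> (p - smult (coeff p d / coeff (B d) d) (B d))"
    for p d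
    using add[of "smult (coeff p d / coeff (B d) d) (B d)" "p - smult (coeff p d / coeff (B d) d) (B d)"]
    by (simp add: smult)
  have dg: "coeff (p - smult (coeff p d / coeff (B d) d) (B d)) i = 0" if "degree p \<le> d" "d \<le> i" for p d i
  proof (cases "i = d")
    case True
    thus ?thesis using lc[of d] by simp
  next
    case False
    thus ?thesis using that by (simp add: coeff_eq_0 deg)
  qed
  \<comment> \<open>Stated with coefficients instead of degree p < d, so that the case d = 0 means p = 0.\<close>
  have low: "\<Lambda> p = 0" if "\<forall>i\<ge>d. coeff p i = 0" "d \<le> n" for d p
    using that
  proof (induction d arbitrary: p)
    case 0
    hence "p = 0" by (intro poly_eqI) simp
    thus ?case using zero0 by simp
  next
    case (Suc d)
    have "degree p \<le> d" using Suc.prems(1) by (intro degree_le) auto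
    hence "\<Lambda> (p - smult (coeff p d / coeff (B d) d) (B d)) = 0"
      using Suc.prems(2) dg[OF \<open>degree p \<le> d\<close>] by (intro Suc.IH allI impI) (assumption | simp)+
    thus ?case using split[of p d] zero[of d] Suc.prems(2) by simp
  qed
  have "\<Lambda> (p - smult (coeff p n / coeff (B n) n) (B n)) = 0"
    using dg[OF p] by (intro low[of n] allI impI) (assumption | simp)+
  thus ?thesis using split[of p n] by simp
qed

section \<open>Majorants and convergence of the bilateral sums\<close>

text \<open>The Gaussian factor of the sum, with the power of \<alpha> for which the ratio of consecutive values
depends on q^k \<alpha> alone. It is polymorphic because the same expression over the reals bounds its
norm.\<close>

definition theta_weight :: "'a::field \<Rightarrow> 'a \<Rightarrow> int \<Rightarrow> 'a" where
  "theta_weight q \<alpha> k = q powi (2 * k * k - k) * \<alpha> powi (4 * k)"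

lemma theta_weight_Suc:
  assumes "q \<noteq> 0" "\<alpha> \<noteq> 0"
  shows "theta_weight q \<alpha> (k + 1) = q * (q powi k * \<alpha>) ^ 4 * theta_weight q \<alpha> k"
proof -
  have e: "2 * (k + 1) * (k + 1) - (k + 1) = 1 + k * 4 + (2 * k * k - k)" "4 * (k + 1) = 4 + 4 * k"
    by (simp_all add: algebra_simps)
  have "(q powi k) ^ 4 = q powi (k * 4)"
    by (simp add: power_int_mult)
  moreover have "q powi (1 + k * 4 + (2 * k * k - k)) = q * q powi (k * 4) * q powi (2 * k * k - k)"
    using assms by (subst power_int_add, simp)+ simp
  moreover have "\<alpha> powi (4 + 4 * k) = \<alpha> ^ 4 * \<alpha> powi (4 * k)"
    using assms by (subst power_int_add) simp_all
  ultimately show ?thesis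
    unfolding theta_weight_def e power_mult_distrib by (simp only: mult_ac)
qed

lemma theta_weight_minus:
  assumes "q \<noteq> 0" "\<alpha> \<noteq> 0"
  shows "theta_weight q \<alpha> (- k) = (q powi k) ^ 2 * theta_weight q (1 / \<alpha>) k"
proof -
  have e: "2 * (- k) * (- k) - (- k) = k * 2 + (2 * k * k - k)" "4 * (- k) = - (4 * k)"
    by (simp_all add: algebra_simps)
  have "(q powi k) ^ 2 = q powi (k * 2)"
    by (simp add: power_int_mult)
  thus ?thesis
    unfolding theta_weight_def e using assms
    by (subst power_int_add) (simp_all add: power_int_minus power_int_inverse divide_inverse)
qed

text \<open>As functions of t, these are the generating functions of the q^(-1)-Hermite polynomials in
(z - 1/z) / 2; as functions of z, they carry the whole dependence of the summand on one
parameter.\<close>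

definition kern :: "complex \<Rightarrow> complex \<Rightarrow> complex \<Rightarrow> complex" where
  "kern q t z = qpoch_inf (- (q * t * z)) q * qpoch_inf (q * t / z) q"

text \<open>The value at - x of the Euler product with real base r is \<Prod>j. 1 + x r^j, which dominates
the Euler product at every point of norm at most x and every base of norm r.\<close>

definition qpoch_bound :: "real \<Rightarrow> real \<Rightarrow> real" where
  "qpoch_bound r x = norm (qpoch_inf (- of_real x) (of_real r))"

lemma qpoch_bound_nonneg [simp]: "0 \<le> qpoch_bound r x"
  by (simp add: qpoch_bound_def)

lemma qpoch_bound_step:
  assumes "0 \<le> r" "r < 1" "0 \<le> x"
  shows "qpoch_bound r x = (1 + x) * qpoch_bound r (r * x)"
proof -
  have "norm (1 + complex_of_real x) = 1 + x"
    using assms by (metis norm_of_real of_real_1 of_real_add abs_of_nonneg add_nonneg_nonneg zero_le_one)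
  thus ?thesis
    unfolding qpoch_bound_def using assms
    by (subst qpoch_inf_step) (simp_all add: norm_mult mult_ac)
qed

text \<open>Here R bounds the norms of the three parameters. The majorant depends on the parameters only
through R, so that it also dominates all sums in which they are scaled down; the extra power of x
leaves room for polynomial factors.\<close>

definition majorant :: "real \<Rightarrow> real \<Rightarrow> real \<Rightarrow> int \<Rightarrow> int \<Rightarrow> real" where
  "majorant r A R i k = (let x = r powi k * A in
     theta_weight r A k * x powi i * (qpoch_bound r (r * R * x) * qpoch_bound r (r * R / x)) ^ 3)"

lemma majorant_nonneg:
  assumes "0 < r" "0 < A"
  shows "0 \<le> majorant r A R i k"
  unfolding majorant_def theta_weight_def Let_def using assms
  by (intro mult_nonneg_nonneg zero_le_power zero_le_power_int) auto

text \<open>The theta weight contributes x^4, while each of the three kernels grows at most by the factor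
1 + R / x, so that one power of x survives: the ratio of consecutive terms tends to 0.\<close>

lemma majorant_Suc_le:
  assumes "0 < r" "r < 1" "0 < A" "0 \<le> R"
  defines "x \<equiv> \<lambda>k. r powi k * A"
  shows "majorant r A R i (k + 1) \<le> r powi (1 + i) * x k * (x k + R) ^ 3 * majorant r A R i k"
proof -
  define X where "X = x k"
  have X: "0 < X" using assms by (simp add: X_def)
  have x1: "r powi (k + 1) * A = r * X"
    using assms by (simp add: power_int_add X_def)
  define P where "P = qpoch_bound r (r * R * (r * X))"
  define Q where "Q = qpoch_bound r (r * R / X)"
  have P: "qpoch_bound r (r * R * X) = (1 + r * R * X) * P"
    unfolding P_def using assms X by (subst qpoch_bound_step) (simp_all add: mult_ac)
  have Q: "qpoch_bound r (r * R / (r * X)) = (1 + R / X) * Q"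
    unfolding Q_def using assms X by (subst qpoch_bound_step) (simp_all add: mult_ac)
  have pos: "0 \<le> theta_weight r A k" "0 \<le> P" "0 \<le> Q"
    using assms by (simp_all add: theta_weight_def P_def Q_def)
  have "majorant r A R i (k + 1) = r * X ^ 4 * theta_weight r A k * (r * X) powi i * (P * ((1 + R / X) * Q)) ^ 3"
    unfolding majorant_def Let_def x1 P_def[symmetric] Q
    using assms by (simp add: theta_weight_Suc X_def)
  also have "\<dots> = r powi (1 + i) * X * (X + R) ^ 3 * (theta_weight r A k * X powi i * (P * Q) ^ 3)"
  proof -
    have "(1 + R / X) = (X + R) / X" using X by (simp add: field_simps)
    moreover have "r powi (1 + i) = r * r powi i" using assms by (simp add: power_int_add)
    moreover have "X ^ 4 = X * X ^ 3" by (simp add: eval_nat_numeral)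
    ultimately show ?thesis
      using X by (simp add: power_mult_distrib power_divide power_int_mult_distrib)
  qed
  also have "\<dots> \<le> r powi (1 + i) * X * (X + R) ^ 3 * (theta_weight r A k * X powi i * ((1 + r * R * X) * P * Q) ^ 3)"
  proof (intro mult_left_mono power_mono mult_right_mono)
    show "P \<le> (1 + r * R * X) * P"
      using assms X pos(2) by (simp add: mult_le_cancel_right1)
  qed (use assms X pos in auto)
  also have "\<dots> = r powi (1 + i) * X * (X + R) ^ 3 * majorant r A R i k"
    unfolding majorant_def Let_def Q_def X_def x_def P[unfolded X_def x_def] by (simp add: P_def X_def x_def)
  finally show ?thesis by (simp add: X_def)
qed

lemma majorant_summable_nat:
  assumes "0 < r" "r < 1" "0 < A" "0 \<le> R"
  shows "summable (\<lambda>n. majorant r A R i (int n))"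
proof -
  define c where "c = (\<lambda>n. r powi (1 + i) * (r ^ n * A) * (r ^ n * A + R) ^ 3)"
  have "c \<longlonglongrightarrow> r powi (1 + i) * (0 * A) * (0 * A + R) ^ 3"
    unfolding c_def using assms by (intro tendsto_intros LIMSEQ_realpow_zero) auto
  hence "eventually (\<lambda>n. c n < 1 / 2) sequentially"
    by (rule order_tendstoD) simp
  then obtain N where N: "\<And>n. n \<ge> N \<Longrightarrow> c n < 1 / 2"
    by (auto simp: eventually_sequentially)
  show ?thesis
  proof (rule summable_ratio_test)
    fix n assume "n \<ge> N"
    have nn: "0 \<le> majorant r A R i j" for j
      using assms by (intro majorant_nonneg)
    have "majorant r A R i (int n + 1) \<le> c n * majorant r A R i (int n)"
      using majorant_Suc_le[OF assms, of i "int n"] by (simp add: c_def)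
    also have "\<dots> \<le> 1 / 2 * majorant r A R i (int n)"
      using N[OF \<open>n \<ge> N\<close>] nn by (intro mult_right_mono) auto
    finally show "norm (majorant r A R i (int (Suc n))) \<le> 1 / 2 * norm (majorant r A R i (int n))"
      using nn by (simp add: add.commute)
  qed simp
qed

text \<open>The kernel bounds are invariant under x \<mapsto> 1 / x, so the half-line of negative k reduces to
that of positive k for A replaced by 1 / A.\<close>

lemma majorant_minus:
  assumes "0 < r" "0 < A"
  shows "majorant r A R i (- k) = A\<^sup>2 * majorant r (1 / A) R (2 - i) k"
proof -
  define X where "X = r powi k * (1 / A)"
  have X: "0 < X" using assms by (simp add: X_def)
  have x: "r powi (- k) * A = 1 / X"
    using assms by (simp add: X_def power_int_minus field_simps)
  have "theta_weight r A (- k) * (1 / X) powi i = A\<^sup>2 * (theta_weight r (1 / A) k * X powi (2 - i))"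
  proof -
    have "r powi k = X * A" using assms by (simp add: X_def)
    moreover have "X powi (2 - i) = X\<^sup>2 * (1 / X) powi i"
      using X by (simp add: power_int_diff power_int_divide_distrib)
    ultimately show ?thesis
      using assms by (simp add: theta_weight_minus power_mult_distrib)
  qed
  moreover have "qpoch_bound r (r * R * (1 / X)) * qpoch_bound r (r * R / (1 / X)) = qpoch_bound r (r * R * X) * qpoch_bound r (r * R / X)"
    by (simp add: mult.commute)
  ultimately show ?thesis
    unfolding majorant_def Let_def x X_def[symmetric] by (simp only: mult.assoc)
qed

lemma summable_on_int_split:
  fixes f :: "int \<Rightarrow> 'a::banach"
  assumes "(\<lambda>n. f (int n)) summable_on UNIV" "(\<lambda>n. f (- int n)) summable_on UNIV"
  shows "f summable_on UNIV"
proof -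
  have "bij_betw int UNIV {0..}"
    by (rule bij_betw_byWitness[where f' = nat]) auto
  hence 1: "f summable_on {0..}"
    using assms(1) summable_on_reindex_bij_betw by blast
  have "bij_betw (\<lambda>n. - int n) UNIV {..0}"
    by (rule bij_betw_byWitness[where f' = "\<lambda>k. nat (- k)"]) auto
  hence "f summable_on {..0}"
    using assms(2) summable_on_reindex_bij_betw[of "\<lambda>n. - int n" UNIV "{..0}" f] by simp
  hence 2: "f summable_on {..<0}"
    by (rule summable_on_subset_banach) auto
  have "f summable_on ({0..} \<union> {..<0})"
    by (intro summable_on_Un_disjoint 1 2) auto
  also have "{0..} \<union> {..<0::int} = UNIV" by auto
  finally show ?thesis .
qed

lemma majorant_summable:
  assumes "0 < r" "r < 1" "0 < A" "0 \<le> R"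
  shows "majorant r A R i summable_on UNIV"
proof (rule summable_on_int_split)
  show "(\<lambda>n. majorant r A R i (int n)) summable_on UNIV"
    using majorant_summable_nat[OF assms] majorant_nonneg assms by (intro summable_nonneg_imp_summable_on)
  have "(\<lambda>n. majorant r (1 / A) R (2 - i) (int n)) summable_on UNIV"
    using majorant_summable_nat[of r "1 / A" R "2 - i"] assms
    by (intro summable_nonneg_imp_summable_on majorant_nonneg) auto
  thus "(\<lambda>n. majorant r A R i (- int n)) summable_on UNIV"
    unfolding majorant_minus[OF assms(1,3)] by (rule summable_on_cmult_right)
qed

lemma norm_kern_le:
  assumes "norm q < 1" "norm t \<le> R"
  shows "norm (kern q t z) \<le> qpoch_bound (norm q) (norm q * R * norm z) * qpoch_bound (norm q) (norm q * R / norm z)"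
  unfolding kern_def norm_mult qpoch_bound_def
  using assms
  by (intro mult_mono norm_qpoch_inf_le)
     (auto simp: norm_mult norm_divide intro!: mult_left_mono mult_right_mono divide_right_mono)

lemma norm_summand_le:
  fixes \<alpha> :: complex
  assumes q: "norm q < 1"
    and t: "norm a \<le> R" "norm b \<le> R" "norm c \<le> R"
  defines "z \<equiv> \<lambda>k. q powi k * \<alpha>"
  shows "norm (theta_weight q \<alpha> k * z k powi i * (kern q a (z k) * kern q b (z k) * kern q c (z k)))
    \<le> majorant (norm q) (norm \<alpha>) R i k"
proof -
  define K where "K = qpoch_bound (norm q) (norm q * R * norm (z k)) * qpoch_bound (norm q) (norm q * R / norm (z k))"
  have K: "0 \<le> K" by (simp add: K_def)
  have "norm (kern q a (z k) * kern q b (z k) * kern q c (z k)) \<le> K * K * K"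
    unfolding norm_mult K_def using assms by (intro mult_mono norm_kern_le mult_nonneg_nonneg) auto
  hence "norm (theta_weight q \<alpha> k * z k powi i) * norm (kern q a (z k) * kern q b (z k) * kern q c (z k)) \<le>
     norm (theta_weight q \<alpha> k * z k powi i) * K ^ 3"
    by (intro mult_left_mono) (simp_all add: eval_nat_numeral mult_ac)
  thus ?thesis
    unfolding majorant_def Let_def theta_weight_def K_def z_def
    by (simp add: norm_mult norm_power_int)
qed

text \<open>Tannery's theorem, obtained from dominated convergence for the counting measure.\<close>

lemma dominated_convergence_infsum:
  fixes f :: "nat \<Rightarrow> 'a \<Rightarrow> complex"
  assumes g: "g summable_on UNIV" and le: "\<And>n k. norm (f n k) \<le> g k"
    and lim: "\<And>k. (\<lambda>n. f n k) \<longlonglongrightarrow> h k"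
  shows "(\<lambda>n. \<Sum>\<^sub>\<infinity>k. f n k) \<longlonglongrightarrow> (\<Sum>\<^sub>\<infinity>k. h k)"
proof -
  have "(\<lambda>k. norm (g k)) summable_on UNIV"
    using g summable_on_iff_abs_summable_on_real by blast
  hence g': "integrable (count_space UNIV) g"
    using abs_summable_equivalent[of g UNIV] by (simp only: Infinite_Set_Sum.abs_summable_on_def)
  have le': "norm (h k) \<le> g k" for k
    by (rule LIMSEQ_le_const2[OF tendsto_norm[OF lim[of k]]]) (use le in auto)
  have sums: "infsum u UNIV = integral\<^sup>L (count_space UNIV) u" if "\<And>k. norm (u k) \<le> g k" for u :: "'a \<Rightarrow> complex"
  proof -
    have "(\<lambda>k. norm (u k)) summable_on UNIV"
      using Infinite_Sum.abs_summable_on_comparison_test'[OF g, of u] that by auto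
    thus ?thesis
      by (simp add: abs_summable_equivalent infsetsum_infsum[symmetric] infsetsum_def)
  qed
  have "(\<lambda>n. integral\<^sup>L (count_space UNIV) (f n)) \<longlonglongrightarrow> integral\<^sup>L (count_space UNIV) h"
    by (rule integral_dominated_convergence[where w = g]) (use g' le lim in auto)
  thus ?thesis
    using le le' by (simp add: sums)
qed

section \<open>The bilateral sum without polynomials\<close>

locale q_lattice =
  fixes q \<alpha> :: complex
  assumes q_nz: "q \<noteq> 0" and norm_q: "norm q < 1" and \<alpha>_nz: "\<alpha> \<noteq> 0"
begin

definition z :: "int \<Rightarrow> complex" where
  "z k = q powi k * \<alpha>"

lemma z_nz [simp]: "z k \<noteq> 0"
  using q_nz \<alpha>_nz by (simp add: z_def)

lemma z_Suc: "z (k + 1) = q * z k"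
  using q_nz by (simp add: z_def power_int_add)

definition K :: "complex \<Rightarrow> complex \<Rightarrow> complex \<Rightarrow> int \<Rightarrow> complex" where
  "K a b c k = kern q a (z k) * kern q b (z k) * kern q c (z k)"

text \<open>The summand for m = n = 0 with the infinite products in its denominators cleared. Unlike the
original weight, it is meaningful for all values of the parameters.\<close>

definition W :: "complex \<Rightarrow> complex \<Rightarrow> complex \<Rightarrow> int \<Rightarrow> complex" where
  "W a b c k = (1 + (z k)\<^sup>2) * theta_weight q \<alpha> k * K a b c k"

lemma K_perm: "K a b c k = K b a c k" "K a b c k = K a c b k"
  by (simp_all add: K_def mult_ac)

lemma W_perm: "W a b c = W b a c" "W a b c = W a c b"
  using K_perm by (auto simp: W_def fun_eq_iff)

lemma theta_z_K_summable: "(\<lambda>k. theta_weight q \<alpha> k * z k powi i * K a b c k) summable_on UNIV"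
proof (rule abs_summable_summable, rule Infinite_Sum.abs_summable_on_comparison_test')
  define R where "R = max (norm a) (max (norm b) (norm c))"
  show "majorant (norm q) (norm \<alpha>) R i summable_on UNIV"
    using q_nz norm_q \<alpha>_nz by (intro majorant_summable) (auto simp: R_def le_max_iff_disj)
  show "norm (theta_weight q \<alpha> k * z k powi i * K a b c k) \<le> majorant (norm q) (norm \<alpha>) R i k" for k
    unfolding K_def z_def by (rule norm_summand_le) (use norm_q in \<open>auto simp: R_def le_max_iff_disj\<close>)
qed

text \<open>Multiplication by z - 1/z shifts the exponent i up and down by one, so the exponent has to be
general in the induction on the polynomial.\<close>

lemma theta_z_K_poly_summable:
  "(\<lambda>k. theta_weight q \<alpha> k * z k powi i * K a b c k * poly p (z k - 1 / z k)) summable_on UNIV"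
proof (induction p arbitrary: i)
  case 0
  show ?case by simp
next
  case (pCons u p)
  let ?t = "\<lambda>i k. theta_weight q \<alpha> k * z k powi i * K a b c k"
  have "?t i k * poly (pCons u p) (z k - 1 / z k) =
      ?t i k * u + ?t (i + 1) k * poly p (z k - 1 / z k) + (- 1) * (?t (i - 1) k * poly p (z k - 1 / z k))" for k
    by (simp add: power_int_add power_int_diff algebra_simps)
  moreover have "(\<lambda>k. ?t i k * u + ?t (i + 1) k * poly p (z k - 1 / z k) +
      (- 1) * (?t (i - 1) k * poly p (z k - 1 / z k))) summable_on UNIV"
    by (intro summable_on_add summable_on_cmult_left summable_on_cmult_right theta_z_K_summable pCons.IH)
  ultimately show ?case by presburger
qed

lemma W_poly_summable: "(\<lambda>k. W a b c k * poly p (z k - 1 / z k)) summable_on UNIV"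
proof -
  let ?t = "\<lambda>i k. theta_weight q \<alpha> k * z k powi i * K a b c k * poly p (z k - 1 / z k)"
  have "W a b c k * poly p (z k - 1 / z k) = ?t 0 k + ?t 2 k" for k
    by (simp add: W_def algebra_simps)
  moreover have "(\<lambda>k. ?t 0 k + ?t 2 k) summable_on UNIV"
    by (intro summable_on_add theta_z_K_poly_summable)
  ultimately show ?thesis by presburger
qed

lemma W_summable: "W a b c summable_on UNIV"
  using W_poly_summable[of a b c 1] by simp

definition S :: "complex \<Rightarrow> complex \<Rightarrow> complex \<Rightarrow> complex" where
  "S a b c = (\<Sum>\<^sub>\<infinity>k. W a b c k)"

lemma S_perm: "S a b c = S b a c" "S a b c = S a c b"
  unfolding S_def using W_perm by metis+

lemma kern_div_q:
  assumes "w \<noteq> 0"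
  shows "kern q (t / q) w = (1 + t * w) * (1 - t / w) * kern q t w"
proof -
  have "qpoch_inf (- (t * w)) q = (1 + t * w) * qpoch_inf (- (q * t * w)) q"
    using qpoch_inf_step[OF norm_q, of "- (t * w)"] by (simp add: mult_ac)
  moreover have "qpoch_inf (t / w) q = (1 - t / w) * qpoch_inf (q * t / w) q"
    using qpoch_inf_step[OF norm_q, of "t / w"] by (simp add: mult_ac)
  ultimately show ?thesis
    using q_nz by (simp add: kern_def mult_ac)
qed

lemma kern_mult_q:
  assumes "w \<noteq> 0"
  shows "(1 + q * t * w) * kern q t (q * w) = (1 - t / w) * kern q t w"
proof -
  have "qpoch_inf (- (q * t * w)) q = (1 + q * t * w) * qpoch_inf (- (q * t * (q * w))) q"
    using qpoch_inf_step[OF norm_q, of "- (q * t * w)"] by (simp add: mult_ac)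
  moreover have "qpoch_inf (t / w) q = (1 - t / w) * qpoch_inf (q * t / w) q"
    using qpoch_inf_step[OF norm_q, of "t / w"] by (simp add: mult_ac)
  ultimately show ?thesis
    using q_nz by (simp add: kern_def mult_ac)
qed

text \<open>The one summation by parts on which everything rests. With
A = (z-a)(z-b)(z-c) and B = (1+az)(1+bz)(1+cz), one has
z A - B = (1 + z^2) (z^2 - 1 - (a+b+c+abc) z). The functional equations of the theta weight and of the
kernels turn the B-part, moved from z to q z, into the A-part, so the summand is a difference of
consecutive values of one function.\<close>

lemma W_telescopes:
  "(\<Sum>\<^sub>\<infinity>k. W a b c k * (z k - 1 / z k - (a + b + c + a * b * c))) = 0"
proof -
  define U where "U k = theta_weight q \<alpha> k / z k * ((1 + a * z k) * (1 + b * z k) * (1 + c * z k)) * K a b c k" for k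
  let ?t = "\<lambda>i k. theta_weight q \<alpha> k * z k powi i * K a b c k"
  have "U k = ?t (- 1) k + (a + b + c) * ?t 0 k + (a * b + a * c + b * c) * ?t 1 k + a * b * c * ?t 2 k" for k
    by (simp add: U_def power_int_minus field_simps power2_eq_square)
  moreover have "(\<lambda>k. ?t (- 1) k + (a + b + c) * ?t 0 k + (a * b + a * c + b * c) * ?t 1 k + a * b * c * ?t 2 k)
      summable_on UNIV"
    by (intro summable_on_add summable_on_cmult_right theta_z_K_summable)
  ultimately have U: "U summable_on UNIV"
    by (simp add: fun_eq_iff cong: summable_on_cong)
  \<comment> \<open>A bilateral telescoping sum of a summable function is 0 by shift invariance.\<close>
  have bij: "bij_betw (\<lambda>k::int. k + 1) UNIV UNIV"
    by (rule bij_betw_byWitness[where f' = "\<lambda>k. k - 1"]) auto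
  define h where "h = (\<lambda>k. W a b c k * (z k - 1 / z k - (a + b + c + a * b * c)))"
  have h: "h summable_on UNIV"
    using W_poly_summable[of a b c "[: - (a + b + c + a * b * c), 1 :]"] by (simp add: h_def algebra_simps)
  have step: "U (k + 1) = h k + U k" for k
  proof -
    define Z where "Z = z k"
    have Z: "Z \<noteq> 0" by (simp add: Z_def)
    have step: "(1 + t * (q * Z)) * kern q t (q * Z) = (1 - t / Z) * kern q t Z" for t
      using kern_mult_q[OF Z, of t] by (simp add: mult_ac)
    have th: "theta_weight q \<alpha> (k + 1) = q * Z ^ 4 * theta_weight q \<alpha> k"
      unfolding theta_weight_Suc[OF q_nz \<alpha>_nz] Z_def z_def ..
    have "U (k + 1) = q * Z ^ 4 * theta_weight q \<alpha> k / (q * Z) *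
        (((1 + a * (q * Z)) * kern q a (q * Z)) * ((1 + b * (q * Z)) * kern q b (q * Z)) *
         ((1 + c * (q * Z)) * kern q c (q * Z)))"
      unfolding U_def K_def z_Suc th Z_def[symmetric] by (simp only: mult_ac)
    also have "\<dots> = theta_weight q \<alpha> k * (Z ^ 3 * ((1 - a / Z) * (1 - b / Z) * (1 - c / Z))) * K a b c k"
      unfolding step K_def using q_nz Z by (simp add: Z_def eval_nat_numeral)
    also have "Z ^ 3 * ((1 - a / Z) * (1 - b / Z) * (1 - c / Z)) = (Z - a) * (Z - b) * (Z - c)"
      using Z by (simp add: field_simps eval_nat_numeral)
    finally have U1: "U (k + 1) = theta_weight q \<alpha> k * K a b c k * ((Z - a) * (Z - b) * (Z - c))"
      by (simp add: mult_ac)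
    have "(1 + Z\<^sup>2) * (Z - 1 / Z - (a + b + c + a * b * c)) =
        (Z - a) * (Z - b) * (Z - c) - (1 + a * Z) * (1 + b * Z) * (1 + c * Z) / Z"
      using Z by (simp add: field_simps power2_eq_square)
    hence "W a b c k * (Z - 1 / Z - (a + b + c + a * b * c)) = theta_weight q \<alpha> k * K a b c k *
        ((Z - a) * (Z - b) * (Z - c) - (1 + a * Z) * (1 + b * Z) * (1 + c * Z) / Z)"
      unfolding W_def Z_def by (simp only: mult_ac)
    also have "\<dots> = U (k + 1) - U k"
      unfolding U1 right_diff_distrib by (simp add: U_def Z_def mult_ac)
    finally show ?thesis unfolding Z_def h_def by simp
  qed
  have "(\<Sum>\<^sub>\<infinity>k. U k) = (\<Sum>\<^sub>\<infinity>k. U (k + 1))"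
    by (rule infsum_reindex_bij_betw[OF bij, symmetric])
  also have "\<dots> = (\<Sum>\<^sub>\<infinity>k. h k) + (\<Sum>\<^sub>\<infinity>k. U k)"
    unfolding step by (rule infsum_add[OF h U])
  finally show ?thesis by (simp add: h_def)
qed

text \<open>Dividing a by q multiplies the kernel by (1 + a z)(1 - a / z) = 1 - a^2 + a (z - 1/z), and
the telescoping sum replaces z - 1/z by a + b + c + abc.\<close>

lemma S_div_q: "S (a / q) b c = (1 + a * b) * (1 + a * c) * S a b c"
proof -
  define h where "h = (\<lambda>k. W a b c k * (z k - 1 / z k - (a + b + c + a * b * c)))"
  have h: "h summable_on UNIV"
    using W_poly_summable[of a b c "[: - (a + b + c + a * b * c), 1 :]"] by (simp add: h_def algebra_simps)
  have "W (a / q) b c k = (1 + a * b) * (1 + a * c) * W a b c k + a * h k" for k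
  proof -
    have "(1 + a * z k) * (1 - a / z k) =
        (1 + a * b) * (1 + a * c) + a * (z k - 1 / z k - (a + b + c + a * b * c))"
      by (simp add: field_simps)
    moreover have "W (a / q) b c k = (1 + a * z k) * (1 - a / z k) * W a b c k"
      unfolding W_def K_def kern_div_q[OF z_nz] by (simp only: mult_ac)
    ultimately have "W (a / q) b c k =
        ((1 + a * b) * (1 + a * c) + a * (z k - 1 / z k - (a + b + c + a * b * c))) * W a b c k"
      by simp
    also have "\<dots> = (1 + a * b) * (1 + a * c) * W a b c k + a * h k"
      unfolding h_def distrib_right by (simp only: mult_ac)
    finally show ?thesis .
  qed
  hence "S (a / q) b c = (\<Sum>\<^sub>\<infinity>k. (1 + a * b) * (1 + a * c) * W a b c k + a * h k)"
    by (simp add: S_def)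
  also have "\<dots> = (\<Sum>\<^sub>\<infinity>k. (1 + a * b) * (1 + a * c) * W a b c k) + (\<Sum>\<^sub>\<infinity>k. a * h k)"
    by (intro infsum_add summable_on_cmult_right W_summable h)
  also have "\<dots> = (1 + a * b) * (1 + a * c) * S a b c + a * (\<Sum>\<^sub>\<infinity>k. h k)"
    unfolding S_def by (simp add: infsum_cmult_right')
  also have "(\<Sum>\<^sub>\<infinity>k. h k) = 0"
    unfolding h_def by (rule W_telescopes)
  finally show ?thesis by simp
qed

lemma S_mult_q: "S a b c = (1 + q * a * b) * (1 + q * a * c) * S (q * a) b c"
  using S_div_q[of "q * a" b c] q_nz by simp

lemma S_scale: "S a b c =
  qpoch (- (q * a * b)) q (2 * n) * qpoch (- (q * a * c)) q (2 * n) * qpoch (- (q * b * c)) q (2 * n) *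
  S (a * q ^ n) (b * q ^ n) (c * q ^ n)"
proof (induction n)
  case 0
  show ?case by simp
next
  case (Suc n)
  define A B C where "A = a * q ^ n" and "B = b * q ^ n" and "C = c * q ^ n"
  \<comment> \<open>One step for each parameter in turn; each pair meets two of the three steps.\<close>
  have "S A B C = (1 + q * A * B) * (1 + q * A * C) * S (q * A) B C"
    by (rule S_mult_q)
  also have "S (q * A) B C = (1 + q * B * (q * A)) * (1 + q * B * C) * S (q * A) (q * B) C"
    using S_mult_q[of B "q * A" C] S_perm by metis
  also have "S (q * A) (q * B) C = (1 + q * C * (q * A)) * (1 + q * C * (q * B)) * S (q * A) (q * B) (q * C)"
    using S_mult_q[of C "q * A" "q * B"] S_perm by metis
  finally have 1: "S A B C = ((1 + q * A * B) * (1 + q * q * A * B)) * ((1 + q * A * C) * (1 + q * q * A * C)) *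
     ((1 + q * B * C) * (1 + q * q * B * C)) * S (q * A) (q * B) (q * C)"
    by (simp only: mult_ac)
  have 2: "qpoch (- (q * s * t)) q (2 * Suc n) = qpoch (- (q * s * t)) q (2 * n) *
      ((1 + q * (s * q ^ n) * (t * q ^ n)) * (1 + q * q * (s * q ^ n) * (t * q ^ n)))" for s t
  proof -
    have e: "2 * Suc n = Suc (Suc (2 * n))" and qq: "q ^ (2 * n) = q ^ n * q ^ n"
      by (simp_all add: mult_2 power_add)
    show ?thesis
      unfolding e qpoch_Suc power_Suc qq by (simp only: mult_minus_left mult_minus_right diff_minus_eq_add mult_ac)
  qed
  show ?case
    unfolding 2 by (subst Suc) (use 1 in \<open>simp add: A_def B_def C_def mult_ac\<close>)
qed

lemma kern_tendsto_1: "(\<lambda>n. kern q (t * q ^ n) w) \<longlonglongrightarrow> 1"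
proof -
  have "(\<lambda>n. qpoch_inf (- (q * t * w) * q ^ n) q * qpoch_inf (q * t / w * q ^ n) q) \<longlonglongrightarrow> 1 * 1"
    by (intro tendsto_mult qpoch_inf_tendsto_1 norm_q)
  thus ?thesis by (simp add: kern_def mult_ac)
qed

lemma kern_0 [simp]: "kern q 0 w = 1"
  by (simp add: kern_def)

lemma S_scale_tendsto: "(\<lambda>n. S (a * q ^ n) (b * q ^ n) (c * q ^ n)) \<longlonglongrightarrow> S 0 0 0"
  unfolding S_def
proof (rule dominated_convergence_infsum)
  define R where "R = max (norm a) (max (norm b) (norm c))"
  let ?M = "\<lambda>i. majorant (norm q) (norm \<alpha>) R i"
  show "(\<lambda>k. ?M 0 k + ?M 2 k) summable_on UNIV"
    using q_nz norm_q \<alpha>_nz by (intro summable_on_add majorant_summable) (auto simp: R_def le_max_iff_disj)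
  fix k
  have shrink: "norm (t * q ^ n) \<le> R" if "t \<in> {a, b, c}" for t n
  proof -
    have "norm (t * q ^ n) \<le> norm t * 1"
      unfolding norm_mult norm_power using norm_q by (intro mult_left_mono power_le_one) auto
    also have "\<dots> \<le> R" using that by (auto simp: R_def le_max_iff_disj)
    finally show ?thesis .
  qed
  show "norm (W (a * q ^ n) (b * q ^ n) (c * q ^ n) k) \<le> ?M 0 k + ?M 2 k" for n
  proof -
    let ?t = "\<lambda>i. theta_weight q \<alpha> k * z k powi i * K (a * q ^ n) (b * q ^ n) (c * q ^ n) k"
    have "W (a * q ^ n) (b * q ^ n) (c * q ^ n) k = ?t 0 + ?t 2"
      by (simp add: W_def algebra_simps)
    moreover have "norm (?t i) \<le> ?M i k" for i
      unfolding K_def z_def by (rule norm_summand_le) (use norm_q shrink in auto)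
    ultimately show ?thesis
      using norm_triangle_mono by metis
  qed
  have "(\<lambda>n. W (a * q ^ n) (b * q ^ n) (c * q ^ n) k) \<longlonglongrightarrow> (1 + (z k)\<^sup>2) * theta_weight q \<alpha> k * (1 * 1 * 1)"
    unfolding W_def K_def by (intro tendsto_intros kern_tendsto_1)
  thus "(\<lambda>n. W (a * q ^ n) (b * q ^ n) (c * q ^ n) k) \<longlonglongrightarrow> W 0 0 0 k"
    by (simp add: W_def K_def)
qed

lemma S_eq_S_0:
  "S a b c = qpoch_inf (- (q * a * b)) q * qpoch_inf (- (q * a * c)) q * qpoch_inf (- (q * b * c)) q * S 0 0 0"
proof (rule LIMSEQ_unique)
  have lim: "(\<lambda>n. qpoch y q (2 * n)) \<longlonglongrightarrow> qpoch_inf y q" for y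
    using LIMSEQ_subseq_LIMSEQ[OF qpoch_tendsto_qpoch_inf[OF norm_q, of y], of "\<lambda>n. 2 * n"]
    by (simp add: strict_mono_def o_def)
  have "(\<lambda>n. qpoch (- (q * a * b)) q (2 * n) * qpoch (- (q * a * c)) q (2 * n) *
      qpoch (- (q * b * c)) q (2 * n) * S (a * q ^ n) (b * q ^ n) (c * q ^ n))
    \<longlonglongrightarrow> qpoch_inf (- (q * a * b)) q * qpoch_inf (- (q * a * c)) q * qpoch_inf (- (q * b * c)) q * S 0 0 0"
    by (intro tendsto_mult lim S_scale_tendsto)
  thus "(\<lambda>n. S a b c)
    \<longlonglongrightarrow> qpoch_inf (- (q * a * b)) q * qpoch_inf (- (q * a * c)) q * qpoch_inf (- (q * b * c)) q * S 0 0 0"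
    by (simp only: S_scale[symmetric])
qed auto

text \<open>For a = \<alpha> and b = - 1 / \<alpha> the two kernels vanish on opposite sides of k = 0, so that a single
term is left; comparing it with the closed form of the same sum determines the constant. Since
the terms of S 0 0 0 are those of a theta series, this is the Jacobi triple product.\<close>

lemma S_0: "S 0 0 0 = qpoch_inf q q * qpoch_inf (- (\<alpha>\<^sup>2)) q * qpoch_inf (- (q / \<alpha>\<^sup>2)) q"
proof -
  have zero: "W \<alpha> (- 1 / \<alpha>) 0 k = 0" if "k \<noteq> 0" for k
  proof (cases "k > 0")
    case True
    define j where "j = nat (k - 1)"
    have k: "k = int (Suc j)" using True by (simp add: j_def)
    \<comment> \<open>The kernel with parameter \<alpha> vanishes on the right half of the lattice.\<close>
    have "qpoch_inf (q * \<alpha> / z k) q = 0"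
    proof (rule qpoch_inf_eq_0[OF norm_q, of _ j])
      show "q * \<alpha> / z k * q ^ j = 1"
        unfolding k z_def power_int_of_nat using q_nz \<alpha>_nz by simp
    qed
    thus ?thesis by (simp add: W_def K_def kern_def)
  next
    case False
    define j where "j = nat (- k - 1)"
    have k: "k = - int (Suc j)" using False that by (simp add: j_def)
    \<comment> \<open>The kernel with parameter - 1 / \<alpha> vanishes on the left half.\<close>
    have "qpoch_inf (- (q * (- 1 / \<alpha>) * z k)) q = 0"
    proof (rule qpoch_inf_eq_0[OF norm_q, of _ j])
      show "- (q * (- 1 / \<alpha>) * z k) * q ^ j = 1"
        unfolding k z_def power_int_minus power_int_of_nat using q_nz \<alpha>_nz by (simp add: field_simps)
    qed
    thus ?thesis by (simp add: W_def K_def kern_def)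
  qed
  have "S \<alpha> (- 1 / \<alpha>) 0 = infsum (W \<alpha> (- 1 / \<alpha>) 0) {0}"
    unfolding S_def by (rule infsum_cong_neutral) (use zero in auto)
  also have "\<dots> = (1 + \<alpha>\<^sup>2) * (qpoch_inf (- (q * \<alpha>\<^sup>2)) q * qpoch_inf q q * (qpoch_inf q q * qpoch_inf (- (q / \<alpha>\<^sup>2)) q))"
    using \<alpha>_nz by (simp add: W_def K_def kern_def z_def theta_weight_def power2_eq_square mult_ac)
  also have "\<dots> = qpoch_inf q q * (qpoch_inf q q * qpoch_inf (- (\<alpha>\<^sup>2)) q * qpoch_inf (- (q / \<alpha>\<^sup>2)) q)"
    using qpoch_inf_step[OF norm_q, of "- (\<alpha>\<^sup>2)"] by (simp add: mult_ac)
  finally have "S \<alpha> (- 1 / \<alpha>) 0 = qpoch_inf q q * (qpoch_inf q q * qpoch_inf (- (\<alpha>\<^sup>2)) q * qpoch_inf (- (q / \<alpha>\<^sup>2)) q)" .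
  moreover have "S \<alpha> (- 1 / \<alpha>) 0 = qpoch_inf q q * S 0 0 0"
    using S_eq_S_0[of \<alpha> "- 1 / \<alpha>" 0] \<alpha>_nz by simp
  ultimately show ?thesis
    using qpoch_inf_nonzero[OF norm_q norm_q] by simp
qed

end

section \<open>Orthogonality of the Hahn polynomials\<close>

lemma q_power_neq_1:
  fixes q :: complex
  assumes "norm q < 1" "0 < i"
  shows "q ^ i \<noteq> 1"
proof
  assume "q ^ i = 1"
  hence "norm q ^ i = 1" by (metis norm_one norm_power)
  thus False using power_Suc_less_one[of "norm q" "i - 1"] assms
    by (cases "norm q = 0") (auto simp: power_0_left)
qed

lemma qpoch_self_nz:
  assumes "norm q < 1"
  shows "qpoch q q n \<noteq> 0"
  using qpoch_inf_split[OF assms, of q n] qpoch_inf_nonzero[OF assms assms] by auto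

text \<open>The n-th q-difference of p along the points 1, 1/q, ..., 1/q^n, up to normalization.\<close>

definition q_difference :: "complex \<Rightarrow> nat \<Rightarrow> complex poly \<Rightarrow> complex" where
  "q_difference q n p = (\<Sum>k\<le>n. qpoch (1 / q ^ n) q k / qpoch q q k * (q ^ n) ^ k * poly p (1 / q ^ k))"

text \<open>By the q-binomial theorem the operator maps the monomial of degree j to (q^(-j); q)_n, which has
a vanishing factor for j < n.\<close>

lemma q_difference_leading_coeff:
  assumes "q \<noteq> 0" "norm q < 1" "degree p \<le> n"
  shows "q_difference q n p = coeff p n * qpoch (1 / q ^ n) q n"
proof -
  have monom: "q_difference q n (monom 1 j) = qpoch (1 / q ^ j) q n" for j
  proof -
    have "(q ^ n * (1 / q ^ j)) ^ k = (q ^ n) ^ k * (1 / q ^ k) ^ j" for k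
      unfolding power_mult_distrib power_one_over power_mult[symmetric] by (simp add: mult.commute)
    hence "q_difference q n (monom 1 j) =
        (\<Sum>k\<le>n. qpoch (1 / q ^ n) q k / qpoch q q k * (q ^ n * (1 / q ^ j)) ^ k)"
      unfolding q_difference_def by (simp add: poly_monom mult.assoc)
    also have "\<dots> = qpoch (1 / q ^ j) q n"
      using assms q_power_neq_1 by (intro q_binomial_theorem) auto
    finally show ?thesis .
  qed
  have "q_difference q n p = coeff p n / coeff (monom 1 n) n * q_difference q n (monom 1 n)"
  proof (rule linear_functional_leading_coeff)
    show "q_difference q n (p + r) = q_difference q n p + q_difference q n r" for p r
      unfolding q_difference_def poly_add distrib_left sum.distrib ..
    show "q_difference q n (smult c p) = c * q_difference q n p" for c p
      by (simp add: q_difference_def sum_distrib_left mult_ac)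
    show "q_difference q n (monom 1 j) = 0" if "j < n" for j
      unfolding monom qpoch_def using assms(1) that by (intro prod_zero bexI[of _ j]) auto
  qed (use assms in \<open>simp_all add: degree_monom_eq\<close>)
  thus ?thesis by (simp add: monom)
qed

context q_lattice
begin

text \<open>The functions (z/t, -1/(tz); q)_k of the explicit formula for the Hahn polynomials, written as
polynomials in z - 1/z.\<close>

definition phi :: "complex \<Rightarrow> nat \<Rightarrow> complex poly" where
  "phi t k = (\<Prod>j<k. [: 1 - (q ^ j)\<^sup>2 / t\<^sup>2, - (q ^ j / t) :])"

lemma phi_Suc: "phi t (Suc k) = phi t k * [: 1 - (q ^ k)\<^sup>2 / t\<^sup>2, - (q ^ k / t) :]"
  by (simp add: phi_def mult.commute)

lemma poly_phi:
  assumes "t \<noteq> 0" "w \<noteq> 0"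
  shows "poly (phi t k) (w - 1 / w) = qpoch (w / t) q k * qpoch (- 1 / (t * w)) q k"
proof -
  have "1 - (q ^ j)\<^sup>2 / t\<^sup>2 + (w - 1 / w) * - (q ^ j / t) =
      (1 - w / t * q ^ j) * (1 - - 1 / (t * w) * q ^ j)" for j
    using assms by (simp add: field_simps power2_eq_square)
  thus ?thesis
    by (simp add: phi_def qpoch_def poly_prod prod.distrib[symmetric])
qed

lemma degree_phi:
  assumes "t \<noteq> 0"
  shows "degree (phi t k) = k" "phi t k \<noteq> 0"
proof -
  have "degree (phi t k) = k \<and> phi t k \<noteq> 0"
  proof (induction k)
    case 0
    show ?case by (simp add: phi_def)
  next
    case (Suc k)
    define f where "f = [: 1 - (q ^ k)\<^sup>2 / t\<^sup>2, - (q ^ k / t) :]"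
    have "degree f = 1" "f \<noteq> 0"
      using q_nz assms by (simp_all add: f_def)
    thus ?case
      using Suc unfolding phi_Suc f_def[symmetric] by (simp add: degree_mult_eq)
  qed
  thus "degree (phi t k) = k" "phi t k \<noteq> 0" by auto
qed

lemma coeff_phi:
  assumes "t \<noteq> 0"
  shows "coeff (phi t k) k = (- 1 / t) ^ k * q ^ (k choose 2)"
proof (induction k)
  case 0
  show ?case by (simp add: phi_def numeral_2_eq_2)
next
  case (Suc k)
  have C: "Suc k choose 2 = k + (k choose 2)"
    by (simp add: numeral_2_eq_2)
  have "coeff (phi t k) (Suc k) = 0"
    by (rule coeff_eq_0) (simp add: degree_phi assms)
  hence "coeff (phi t (Suc k)) (Suc k) = coeff (phi t k) k * (- (q ^ k / t))"
    unfolding phi_Suc by (simp add: mult.commute[of "phi t k"])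
  thus ?case
    unfolding Suc C by (simp add: power_add)
qed

text \<open>The reason for using the basis phi: multiplying a kernel by phi t k amounts to replacing its
parameter t by t / q^k.\<close>

lemma kern_div_q_power:
  assumes "t \<noteq> 0" "w \<noteq> 0"
  shows "kern q (t / q ^ k) w = (- (t\<^sup>2)) ^ k / (q ^ (k choose 2))\<^sup>2 * poly (phi t k) (w - 1 / w) * kern q t w"
  unfolding poly_phi[OF assms]
proof (induction k)
  case 0
  show ?case by (simp add: numeral_2_eq_2)
next
  case (Suc k)
  have C: "Suc k choose 2 = k + (k choose 2)"
    by (simp add: numeral_2_eq_2)
  have "kern q (t / q ^ Suc k) w = (1 + t / q ^ k * w) * (1 - t / q ^ k / w) * kern q (t / q ^ k) w"
    using kern_div_q[OF assms(2), of "t / q ^ k"] by (simp add: mult_ac)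
  also have "(1 + t / q ^ k * w) * (1 - t / q ^ k / w) =
      - (t\<^sup>2) / (q ^ k)\<^sup>2 * ((1 - w / t * q ^ k) * (1 - - 1 / (t * w) * q ^ k))"
    using assms q_nz by (simp add: field_simps power2_eq_square)
  finally show ?case
    unfolding Suc C qpoch_Suc by (simp add: power_add power_mult_distrib)
qed

definition L :: "complex \<Rightarrow> complex \<Rightarrow> complex \<Rightarrow> complex poly \<Rightarrow> complex" where
  "L a b c p = (\<Sum>\<^sub>\<infinity>k. W a b c k * poly p (z k - 1 / z k))"

lemma L_has_sum: "((\<lambda>k. W a b c k * poly p (z k - 1 / z k)) has_sum L a b c p) UNIV"
  unfolding L_def by (rule has_sum_infsum[OF W_poly_summable])

lemma L_add: "L a b c (p + r) = L a b c p + L a b c r"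
  unfolding L_def poly_add distrib_left by (intro infsum_add W_poly_summable)

lemma L_smult: "L a b c (smult u p) = u * L a b c p"
  unfolding L_def poly_smult by (simp add: infsum_cmult_right' mult.left_commute)

lemma L_sum: "L a b c (\<Sum>i\<in>I. f i) = (\<Sum>i\<in>I. L a b c (f i))"
  using sum_comp_morphism[of "L a b c" f I] L_smult[of a b c 0 0] by (simp add: L_add o_def)

text \<open>By \<open>kern_div_q_power\<close> this is, up to a constant, the value of S at a / q^i, b / q^l, c,
to which \<open>S_eq_S_0\<close> applies.\<close>

lemma L_phi_phi:
  assumes "a \<noteq> 0" "b \<noteq> 0" "c \<noteq> 0"
  shows "L a b c (phi a i * phi b l) =
    (- 1) ^ (i + l) * (b * c) ^ i * (a * c) ^ l / q ^ (i * l) *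
    qpoch (- 1 / (a * b)) q (i + l) * qpoch (- 1 / (a * c)) q i * qpoch (- 1 / (b * c)) q l * S a b c"
proof -
  define X where "X = (- (a\<^sup>2)) ^ i / (q ^ (i choose 2))\<^sup>2 * ((- (b\<^sup>2)) ^ l / (q ^ (l choose 2))\<^sup>2)"
  have X: "X \<noteq> 0" using assms q_nz by (simp add: X_def)
  have "W (a / q ^ i) (b / q ^ l) c k = X * (W a b c k * poly (phi a i * phi b l) (z k - 1 / z k))" for k
    unfolding W_def K_def kern_div_q_power[OF assms(1) z_nz] kern_div_q_power[OF assms(2) z_nz] X_def poly_mult
    by (simp only: mult_ac)
  hence 1: "S (a / q ^ i) (b / q ^ l) c = X * L a b c (phi a i * phi b l)"
    unfolding S_def L_def infsum_cmult_right'[symmetric] by (intro infsum_cong)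
  have shift: "qpoch_inf (- (q * (s * t) / q ^ k)) q =
      (s * t) ^ k / q ^ (k choose 2) * qpoch (- 1 / (s * t)) q k * qpoch_inf (- (q * s * t)) q"
    if "s \<noteq> 0" "t \<noteq> 0" for s t k
    using qpoch_inf_backward[OF q_nz norm_q, of "- (s * t)" k] that by (simp add: mult.assoc)
  have e: "- (q * (a / q ^ i) * (b / q ^ l)) = - (q * (a * b) / q ^ (i + l))"
     "- (q * (a / q ^ i) * c) = - (q * (a * c) / q ^ i)" "- (q * (b / q ^ l) * c) = - (q * (b * c) / q ^ l)"
    by (simp_all add: power_add)
  have 2: "S (a / q ^ i) (b / q ^ l) c =
      ((a * b) ^ (i + l) / q ^ ((i + l) choose 2)) * ((a * c) ^ i / q ^ (i choose 2)) * ((b * c) ^ l / q ^ (l choose 2)) *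
      (qpoch (- 1 / (a * b)) q (i + l) * qpoch (- 1 / (a * c)) q i * qpoch (- 1 / (b * c)) q l) * S a b c"
    unfolding S_eq_S_0[of "a / q ^ i"] S_eq_S_0[of a b c] e shift[OF assms(1,2)] shift[OF assms(1,3)] shift[OF assms(2,3)]
    by (simp only: mult_ac)
  have 3: "((a * b) ^ (i + l) / q ^ ((i + l) choose 2)) * ((a * c) ^ i / q ^ (i choose 2)) * ((b * c) ^ l / q ^ (l choose 2)) =
      X * ((- 1) ^ (i + l) * (b * c) ^ i * (a * c) ^ l / q ^ (i * l))"
  proof -
    have sg: "(- (a\<^sup>2)) ^ i = (- 1) ^ i * (a ^ i * a ^ i)" "(- (b\<^sup>2)) ^ l = (- 1) ^ l * (b ^ l * b ^ l)"
      using power_minus[of "a\<^sup>2" i] power_minus[of "b\<^sup>2" l] by (simp_all add: power2_eq_square power_mult_distrib)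
    have "(- 1) ^ i * (- 1) ^ i = (1::complex)" "(- 1) ^ l * (- 1) ^ l = (1::complex)"
      by simp_all
    hence cancel: "((- 1) ^ i * u) * ((- 1) ^ l * v) * ((- 1) ^ (i + l) * w) = u * v * (w::complex)" for u v w
      by (simp add: power_add mult_ac)
    define u v w where "u = a ^ i * a ^ i / (q ^ (i choose 2))\<^sup>2"
      and "v = b ^ l * b ^ l / (q ^ (l choose 2))\<^sup>2" and "w = (b * c) ^ i * (a * c) ^ l / q ^ (i * l)"
    have "X = ((- 1) ^ i * u) * ((- 1) ^ l * v)"
      unfolding X_def sg u_def v_def by (simp only: times_divide_eq_right)
    moreover have "(- 1) ^ (i + l) * (b * c) ^ i * (a * c) ^ l / q ^ (i * l) = (- 1) ^ (i + l) * w"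
      unfolding w_def by (simp only: times_divide_eq_right mult.assoc)
    ultimately have X_eq: "X * ((- 1) ^ (i + l) * (b * c) ^ i * (a * c) ^ l / q ^ (i * l)) = u * v * w"
      by (simp only: cancel)
    have "((a * b) ^ (i + l) / q ^ ((i + l) choose 2)) * ((a * c) ^ i / q ^ (i choose 2)) *
        ((b * c) ^ l / q ^ (l choose 2)) = u * v * w"
      unfolding choose_2_add u_def v_def w_def using q_nz
      by (simp add: power_add power_mult_distrib power2_eq_square divide_simps)
    thus ?thesis unfolding X_eq .
  qed
  have "X * L a b c (phi a i * phi b l) = X * ((- 1) ^ (i + l) * (b * c) ^ i * (a * c) ^ l / q ^ (i * l) *
    qpoch (- 1 / (a * b)) q (i + l) * qpoch (- 1 / (a * c)) q i * qpoch (- 1 / (b * c)) q l * S a b c)"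
    unfolding 1[symmetric] 2 3 by (simp only: mult.assoc)
  thus ?thesis unfolding mult_left_cancel[OF X] .
qed

text \<open>The explicit form of the Hahn polynomials, read as polynomials in z - 1/z so that their degrees
and leading coefficients are at hand.\<close>

definition hahn :: "complex \<Rightarrow> complex \<Rightarrow> complex \<Rightarrow> nat \<Rightarrow> complex poly" where
  "hahn a b c n = smult ((- (a * b * c)) ^ n / (q ^ (n choose 2))\<^sup>2)
     (\<Sum>k\<le>n. smult (qpoch (1 / q ^ n) q k / qpoch q q k * (- (q ^ n) / (b * c)) ^ k *
        (qpoch (- 1 / (a * b) * q ^ k) q (n - k) * qpoch (- 1 / (a * c) * q ^ k) q (n - k))) (phi a k))"

lemma poly_hahn:
  assumes "a \<noteq> 0" "b \<noteq> 0" "c \<noteq> 0" "w \<noteq> 0"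
  shows "poly (hahn a b c n) (w - 1 / w) = cdqinvHahn n w a b c q"
proof -
  have "q powi (- 2 * int (n choose 2)) = 1 / (q ^ (n choose 2))\<^sup>2"
  proof -
    have "- 2 * int (n choose 2) = - int ((n choose 2) * 2)" by simp
    thus ?thesis by (simp only: power_int_minus power_int_of_nat power_mult inverse_eq_divide)
  qed
  moreover have "q powi (- int n) = 1 / q ^ n"
    by (simp add: power_int_minus inverse_eq_divide)
  ultimately show ?thesis
    unfolding cdqinvHahn_explicit[OF q_nz assms(4,1-3)] hahn_def poly_smult poly_sum poly_phi[OF assms(1,4)]
    by (simp add: mult_ac)
qed

lemma degree_hahn:
  assumes "a \<noteq> 0"
  shows "degree (hahn a b c n) \<le> n"
  unfolding hahn_def
  by (intro order_trans[OF degree_smult_le] degree_sum_le) (auto simp: degree_phi assms intro: order_trans[OF degree_smult_le])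

text \<open>Only the term k = n of the defining sum reaches degree n.\<close>

lemma coeff_hahn:
  assumes "a \<noteq> 0" "b \<noteq> 0" "c \<noteq> 0"
  shows "coeff (hahn a b c n) n = 1"
proof -
  define E where "E k = qpoch (1 / q ^ n) q k / qpoch q q k * (- (q ^ n) / (b * c)) ^ k *
        (qpoch (- 1 / (a * b) * q ^ k) q (n - k) * qpoch (- 1 / (a * c) * q ^ k) q (n - k))" for k
  define C where "C = n choose 2"
  have "coeff (phi a k) n = 0" if "k < n" for k
    by (rule coeff_eq_0) (simp add: degree_phi assms that)
  hence "(\<Sum>k\<le>n. E k * coeff (phi a k) n) = E n * coeff (phi a n) n"
    by (subst sum.remove[of _ n]) (auto intro!: sum.neutral)
  hence "coeff (hahn a b c n) n = (- (a * b * c)) ^ n / (q ^ C)\<^sup>2 * (E n * coeff (phi a n) n)"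
    unfolding hahn_def E_def[symmetric] C_def by (simp add: coeff_sum)
  also have "E n = (- 1) ^ n / (q ^ n * q ^ C) * (- (q ^ n) / (b * c)) ^ n"
    unfolding E_def qpoch_self_inverse_power[OF q_nz] C_def using qpoch_self_nz[OF norm_q] by simp
  also have "(- (q ^ n) / (b * c)) ^ n = (- 1 / (b * c)) ^ n * (q ^ n * (q ^ C)\<^sup>2)"
  proof -
    have "n * n = n + C * 2"
      unfolding C_def by (induction n) (simp_all add: numeral_2_eq_2)
    hence "(q ^ n) ^ n = q ^ n * (q ^ C)\<^sup>2"
      by (metis power_mult power_add)
    thus ?thesis
      using power_minus[of "q ^ n / (b * c)" n] power_minus[of "1 / (b * c)" n] by (simp add: power_divide)
  qed
  also have "coeff (phi a n) n = (- 1 / a) ^ n * q ^ C"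
    unfolding C_def by (rule coeff_phi[OF assms(1)])
  also have "(- (a * b * c)) ^ n / (q ^ C)\<^sup>2 * ((- 1) ^ n / (q ^ n * q ^ C) *
      ((- 1 / (b * c)) ^ n * (q ^ n * (q ^ C)\<^sup>2)) * ((- 1 / a) ^ n * q ^ C)) =
      ((- (a * b * c)) * (- 1) * (- 1 / (b * c)) * (- 1 / a)) ^ n"
    unfolding power_mult_distrib using q_nz by simp
  also have "\<dots> = 1" using assms by simp
  finally show ?thesis .
qed

text \<open>Expanding the Hahn polynomial in phi a and integrating term by term against phi b l, the index k
enters only through (y q^k; q)_l / q^(kl) with y = - 1 / (ab). That is the value at 1 / q^k of the
monic polynomial with roots y q^j for j < l, so the sum over k is an n-th q-difference of a
polynomial of degree l.\<close>

lemma L_hahn_phi: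
  assumes "a \<noteq> 0" "b \<noteq> 0" "c \<noteq> 0" "l \<le> n"
  shows "L a b c (hahn a b c n * phi b l) =
    (- (a * b * c)) ^ n / (q ^ (n choose 2))\<^sup>2 * (- (a * c)) ^ l *
    (qpoch (- 1 / (a * b)) q n * qpoch (- 1 / (a * c)) q n * qpoch (- 1 / (b * c)) q l) *
    (if l = n then qpoch (1 / q ^ n) q n else 0) * S a b c"
proof -
  define y where "y = - 1 / (a * b)"
  define P where "P = (\<Prod>j<l. [: - (y * q ^ j), 1 :])"
  define E where "E k = qpoch (1 / q ^ n) q k / qpoch q q k" for k
  define N where "N = (- (a * b * c)) ^ n / (q ^ (n choose 2))\<^sup>2"
  define M where "M = (- (a * c)) ^ l * (qpoch y q n * qpoch (- 1 / (a * c)) q n * qpoch (- 1 / (b * c)) q l)"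
  have "degree P = l \<and> coeff P l = 1"
    unfolding P_def
  proof (induction l)
    case (Suc l)
    let ?Q = "\<Prod>j<l. [: - (y * q ^ j), 1 :]"
    have "coeff ?Q (Suc l) = 0" using Suc by (intro coeff_eq_0) simp
    moreover have "degree (?Q * [: - (y * q ^ l), 1 :]) = Suc l"
      using Suc by (subst degree_mult_eq) auto
    ultimately show ?case
      using Suc by (simp add: mult.commute[of ?Q])
  qed simp
  hence P: "degree P \<le> n" "coeff P n = (if l = n then 1 else 0)"
    using assms(4) by (auto simp: coeff_eq_0)
  have PP: "poly P (1 / q ^ k) = (1 / q ^ k) ^ l * qpoch (y * q ^ k) q l" for k
  proof -
    have "poly P (1 / q ^ k) = (\<Prod>j<l. 1 / q ^ k * (1 - y * q ^ k * q ^ j))"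
      unfolding P_def poly_prod using q_nz by (intro prod.cong refl) (simp add: field_simps)
    thus ?thesis by (simp only: prod.distrib prod_constant card_lessThan qpoch_def)
  qed
  have summand: "E k * (- (q ^ n) / (b * c)) ^ k * (qpoch (y * q ^ k) q (n - k) * qpoch (- 1 / (a * c) * q ^ k) q (n - k)) *
      L a b c (phi a k * phi b l) = M * S a b c * (E k * (q ^ n) ^ k * poly P (1 / q ^ k))" if "k \<le> n" for k
  proof -
    have 1: "qpoch (- 1 / (a * c)) q n = qpoch (- 1 / (a * c)) q k * qpoch (- 1 / (a * c) * q ^ k) q (n - k)"
      using qpoch_add[of "- 1 / (a * c)" q k "n - k"] that by simp
    have "qpoch y q (k + l) * qpoch (y * q ^ k) q (n - k) = qpoch y q n * qpoch (y * q ^ k) q l"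
      using qpoch_add[of y q k "n - k"] that by (simp add: qpoch_add)
    moreover have "(- (q ^ n) / (b * c)) ^ k * ((- 1) ^ (k + l) * (b * c) ^ k * (a * c) ^ l / q ^ (k * l)) =
        (- (a * c)) ^ l * (q ^ n) ^ k * (1 / q ^ k) ^ l"
    proof -
      have "(- (q ^ n) / (b * c)) ^ k * ((- 1) ^ (k + l) * (b * c) ^ k * (a * c) ^ l / q ^ (k * l)) =
        (- (q ^ n) / (b * c) * (- 1) * (b * c)) ^ k * ((- 1) * (a * c)) ^ l / q ^ (k * l)"
        unfolding power_mult_distrib power_add by simp
      also have "- (q ^ n) / (b * c) * (- 1) * (b * c) = q ^ n"
        using assms by simp
      also have "(q ^ n) ^ k * ((- 1) * (a * c)) ^ l / q ^ (k * l) = (- (a * c)) ^ l * (q ^ n) ^ k * (1 / q ^ k) ^ l"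
        by (simp add: power_mult power_one_over)
      finally show ?thesis .
    qed
    ultimately have "((- (q ^ n) / (b * c)) ^ k * ((- 1) ^ (k + l) * (b * c) ^ k * (a * c) ^ l / q ^ (k * l))) *
        (qpoch y q (k + l) * qpoch (y * q ^ k) q (n - k)) =
        ((- (a * c)) ^ l * (q ^ n) ^ k * (1 / q ^ k) ^ l) * (qpoch y q n * qpoch (y * q ^ k) q l)"
      by simp
    moreover have "E k * (- (q ^ n) / (b * c)) ^ k * (qpoch (y * q ^ k) q (n - k) * qpoch (- 1 / (a * c) * q ^ k) q (n - k)) *
      L a b c (phi a k * phi b l) = E k * (qpoch (- 1 / (a * c)) q k * qpoch (- 1 / (a * c) * q ^ k) q (n - k)) *
       qpoch (- 1 / (b * c)) q l * S a b c *
       (((- (q ^ n) / (b * c)) ^ k * ((- 1) ^ (k + l) * (b * c) ^ k * (a * c) ^ l / q ^ (k * l))) *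
        (qpoch y q (k + l) * qpoch (y * q ^ k) q (n - k)))"
      unfolding L_phi_phi[OF assms(1-3)] y_def by (simp only: mult_ac)
    ultimately show ?thesis
      unfolding PP M_def 1 by (simp only: mult_ac)
  qed
  have "hahn a b c n * phi b l = smult N (\<Sum>k\<le>n. smult (E k * (- (q ^ n) / (b * c)) ^ k *
     (qpoch (y * q ^ k) q (n - k) * qpoch (- 1 / (a * c) * q ^ k) q (n - k))) (phi a k * phi b l))"
    unfolding hahn_def N_def E_def y_def by (simp only: mult_smult_left sum_distrib_right)
  hence "L a b c (hahn a b c n * phi b l) = N * (\<Sum>k\<le>n. E k * (- (q ^ n) / (b * c)) ^ k *
     (qpoch (y * q ^ k) q (n - k) * qpoch (- 1 / (a * c) * q ^ k) q (n - k)) * L a b c (phi a k * phi b l))"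
    by (simp only: L_smult L_sum)
  also have "\<dots> = N * (\<Sum>k\<le>n. M * S a b c * (E k * (q ^ n) ^ k * poly P (1 / q ^ k)))"
    by (intro arg_cong2[of _ _ _ _ times] sum.cong refl summand) simp
  also have "\<dots> = N * (M * S a b c * q_difference q n P)"
    unfolding q_difference_def E_def sum_distrib_left ..
  also have "q_difference q n P = (if l = n then qpoch (1 / q ^ n) q n else 0)"
    using q_difference_leading_coeff[OF q_nz norm_q P(1)] P(2) by simp
  finally show ?thesis
    unfolding N_def M_def y_def by (simp only: mult_ac)
qed

text \<open>The functional p \<mapsto> L (p_n p) vanishes on phi b l for l < n, hence sees only the coefficient
of degree n of p, which for the Hahn polynomials is 1.\<close>

lemma L_hahn_hahn:
  assumes "a \<noteq> 0" "b \<noteq> 0" "c \<noteq> 0" "m \<le> n"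
  shows "L a b c (hahn a b c n * hahn a b c m) = (if m = n then
     (a\<^sup>2 * b\<^sup>2 * c\<^sup>2 / q) ^ n / (q ^ (n choose 2)) ^ 4 *
     (qpoch q q n * qpoch (- 1 / (a * b)) q n * qpoch (- 1 / (a * c)) q n * qpoch (- 1 / (b * c)) q n) * S a b c
     else 0)"
proof -
  define Q where "Q = q ^ (n choose 2)"
  define Y where "Y = qpoch (- 1 / (a * b)) q n * qpoch (- 1 / (a * c)) q n * qpoch (- 1 / (b * c)) q n"
  have Q: "Q \<noteq> 0" using q_nz by (simp add: Q_def)
  have "L a b c (hahn a b c n * hahn a b c m) =
      coeff (hahn a b c m) n / coeff (phi b n) n * L a b c (hahn a b c n * phi b n)"
    by (rule linear_functional_leading_coeff[where \<Lambda> = "\<lambda>p. L a b c (hahn a b c n * p)" and B = "phi b"])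
       (use assms degree_hahn[OF assms(1), of b c m] in
         \<open>simp_all add: distrib_left L_add L_smult degree_phi L_hahn_phi\<close>)
  moreover have "coeff (hahn a b c m) n = (if m = n then 1 else 0)"
    using coeff_hahn[OF assms(1-3)] degree_hahn[OF assms(1), of b c m] assms(4) by (auto intro: coeff_eq_0)
  moreover have "1 / coeff (phi b n) n * L a b c (hahn a b c n * phi b n) =
     (a\<^sup>2 * b\<^sup>2 * c\<^sup>2 / q) ^ n / Q ^ 4 * (qpoch q q n * Y) * S a b c"
  proof -
    have "1 / coeff (phi b n) n * L a b c (hahn a b c n * phi b n) =
      1 / ((- 1 / b) ^ n * Q) * ((- (a * b * c)) ^ n / Q\<^sup>2 * (- (a * c)) ^ n * Y * ((- 1) ^ n / (q ^ n * Q) * qpoch q q n) * S a b c)"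
      unfolding coeff_phi[OF assms(2)] L_hahn_phi[OF assms(1-3) order_refl] Q_def Y_def
        qpoch_self_inverse_power[OF q_nz] by simp
    also have "\<dots> = (1 / (- 1 / b) * (- (a * b * c)) * (- (a * c)) * (- 1) / q) ^ n / Q ^ 4 * (qpoch q q n * Y) * S a b c"
      unfolding power_divide power_mult_distrib using Q by (simp add: eval_nat_numeral mult_ac)
    also have "1 / (- 1 / b) * (- (a * b * c)) * (- (a * c)) * (- 1) / q = a\<^sup>2 * b\<^sup>2 * c\<^sup>2 / q"
      using assms by (simp add: power2_eq_square)
    finally show ?thesis .
  qed
  ultimately show ?thesis
    unfolding Y_def Q_def by (simp add: mult.assoc)
qed

end

section \<open>The weight in terms of kernels\<close>

text \<open>For negative k the factorial itself may be infinite; its reciprocal is then 0, in agreement with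
division by 0.\<close>

lemma inverse_qpoch_int:
  assumes "q \<noteq> 0" "norm q < 1" "qpoch_inf y q \<noteq> 0"
  shows "1 / qpoch_int y q k = qpoch_inf (y * q powi k) q / qpoch_inf y q"
proof (cases "k \<ge> 0")
  case True
  then obtain n where k: "k = int n" using nonneg_int_cases by blast
  show ?thesis
    using qpoch_inf_split[OF assms(2), of y n] assms(3) by (simp add: k qpoch_int_def)
next
  case False
  define n where "n = nat (- k)"
  have k: "k = - int n" using False by (simp add: n_def)
  have "qpoch_inf (y * q powi k) q = qpoch (y * q powi k) q n * qpoch_inf y q"
  proof -
    have "y * q powi k * q ^ n = y"
      using assms(1) by (simp add: k power_int_minus)
    thus ?thesis using qpoch_inf_split[OF assms(2), of "y * q powi k" n] by (simp only:)
  qed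
  thus ?thesis
    using assms(3) qpoch_int_reciprocal[of y q n] by (simp add: k)
qed

lemma int_choose_2:
  "int n * (int n - 1) div 2 = int (n choose 2)" "- int n * (- int n - 1) div 2 = int ((n choose 2) + n)"
proof -
  have "2 * int (n choose 2) = int n * (int n - 1)"
  proof (induction n)
    case (Suc n)
    have "Suc n choose 2 = n + (n choose 2)" by (simp add: numeral_2_eq_2)
    thus ?case using Suc by (simp add: algebra_simps)
  qed (simp add: numeral_2_eq_2)
  moreover from this have "2 * int ((n choose 2) + n) = - int n * (- int n - 1)"
    by (simp add: algebra_simps)
  ultimately show "int n * (int n - 1) div 2 = int (n choose 2)"
    "- int n * (- int n - 1) div 2 = int ((n choose 2) + n)"
    by presburger+
qed

text \<open>The reflection (y; q)_k = (q^(1-k) / y; q)_\<infinity> / (q / y; q)_\<infinity> (-y)^k q^(k(k-1)/2) at y = 1 / s.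
Unlike in (y; q)_\<infinity> / (y q^k; q)_\<infinity>, the infinite product in the denominator is nonzero here: the
hypothesis on s says exactly that all the factorials of negative index are finite.\<close>

lemma qpoch_int_reflect:
  assumes "q \<noteq> 0" "norm q < 1" "s \<noteq> 0" "qpoch_inf (q * s) q \<noteq> 0"
  shows "qpoch_int (1 / s) q k =
    qpoch_inf (q * s / q powi k) q / qpoch_inf (q * s) q * (- 1 / s) powi k * q powi (k * (k - 1) div 2)"
proof (cases "k \<ge> 0")
  case True
  then obtain n where k: "k = int n" using nonneg_int_cases by blast
  have "(- s) ^ n * (- 1 / s) ^ n = 1"
    unfolding power_mult_distrib[symmetric] using assms(3) by simp
  thus ?thesis
    unfolding k int_choose_2 power_int_of_nat qpoch_inf_backward[OF assms(1-3)]
    using assms by (simp add: qpoch_int_def)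
next
  case False
  define n where "n = nat (- k)"
  have k: "k = - int n" using False by (simp add: n_def)
  define Q where "Q = q ^ (n choose 2)"
  have Q: "Q \<noteq> 0" using assms(1) by (simp add: Q_def)
  have "n * n = n + (n choose 2) * 2"
    by (induction n) (simp_all add: numeral_2_eq_2)
  hence nn: "(q ^ n) ^ n = q ^ n * Q\<^sup>2"
    unfolding Q_def by (metis power_mult power_add)
  \<comment> \<open>At s q^n the backward shift by n steps starts from the product at q s itself.\<close>
  define R where "R = qpoch (1 / (s * q ^ n)) q n"
  have split: "qpoch_inf (q * s) q = (- s) ^ n * q ^ n * Q * R * qpoch_inf (q * s * q ^ n) q"
  proof -
    have "qpoch_inf (q * (s * q ^ n) / q ^ n) q =
        (- (s * q ^ n)) ^ n / Q * R * qpoch_inf (q * (s * q ^ n)) q"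
      unfolding Q_def R_def using assms by (intro qpoch_inf_backward) auto
    moreover have "(- (s * q ^ n)) ^ n = (- s) ^ n * (q ^ n * Q\<^sup>2)"
      unfolding nn[symmetric] power_mult_distrib[symmetric] by simp
    ultimately show ?thesis
      using assms(1) Q by (simp add: power2_eq_square mult_ac)
  qed
  have R: "R \<noteq> 0" using split assms(4) by auto
  have "qpoch_int (1 / s) q k = 1 / R"
    using False by (simp add: qpoch_int_def k R_def power_int_minus field_simps)
  moreover have "qpoch_inf (q * s / q powi k) q = qpoch_inf (q * s * q ^ n) q"
    by (simp add: k power_int_minus field_simps)
  moreover have "(- 1 / s) powi k = (- s) ^ n"
    unfolding k power_int_minus power_int_of_nat by (simp flip: power_inverse)
  moreover have "q powi (k * (k - 1) div 2) = Q * q ^ n"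
    unfolding k int_choose_2 power_int_of_nat Q_def power_add ..
  ultimately show ?thesis
    using assms R split by (simp add: divide_simps mult_ac)
qed

context q_lattice
begin

text \<open>Each quotient of bilateral factorials in the weight is one kernel, up to a constant factor and
an elementary function of k.\<close>

lemma qpoch_int_quotient:
  assumes "t \<noteq> 0" "qpoch_inf (- (q * \<alpha> * t)) q \<noteq> 0" "qpoch_inf (q * t / \<alpha>) q \<noteq> 0"
  shows "qpoch_int (\<alpha> / t) q k / qpoch_int (- (q * \<alpha> * t)) q k =
    kern q t (z k) / (qpoch_inf (- (q * \<alpha> * t)) q * qpoch_inf (q * t / \<alpha>) q) *
    ((- \<alpha> / t) powi k * q powi (k * (k - 1) div 2))"
proof -
  have "qpoch_int (1 / (t / \<alpha>)) q k = qpoch_inf (q * (t / \<alpha>) / q powi k) q / qpoch_inf (q * (t / \<alpha>)) q *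
      (- 1 / (t / \<alpha>)) powi k * q powi (k * (k - 1) div 2)"
    by (rule qpoch_int_reflect) (use q_nz norm_q \<alpha>_nz assms in auto)
  hence 1: "qpoch_int (\<alpha> / t) q k = qpoch_inf (q * t / z k) q / qpoch_inf (q * t / \<alpha>) q *
      ((- \<alpha> / t) powi k * q powi (k * (k - 1) div 2))"
    by (simp add: z_def mult_ac)
  have 2: "1 / qpoch_int (- (q * \<alpha> * t)) q k = qpoch_inf (- (q * t * z k)) q / qpoch_inf (- (q * \<alpha> * t)) q"
    using inverse_qpoch_int[OF q_nz norm_q assms(2), of k] by (simp add: z_def mult_ac)
  have "qpoch_int (\<alpha> / t) q k / qpoch_int (- (q * \<alpha> * t)) q k =
      qpoch_int (\<alpha> / t) q k * (1 / qpoch_int (- (q * \<alpha> * t)) q k)"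
    by simp
  thus ?thesis
    unfolding 1 2 kern_def by (simp add: mult_ac)
qed

text \<open>The elementary functions left over from the three quotients combine with the explicit Gaussian
factor of the summand into the theta weight.\<close>

lemma theta_weight_eq:
  assumes "a \<noteq> 0" "b \<noteq> 0" "c \<noteq> 0"
  defines "T \<equiv> \<lambda>k. q powi (k * (k - 1) div 2)"
  shows "((- \<alpha> / a) powi k * T k) * ((- \<alpha> / b) powi k * T k) * ((- \<alpha> / c) powi k * T k) * T k *
     (- (q * \<alpha> * a * b * c)) powi k = theta_weight q \<alpha> k"
proof -
  have "even (k * (k - 1))" by simp
  then obtain t where t: "k * (k - 1) = 2 * t" by blast
  have "2 * k * k - k = t * 4 + k"
    using t by (simp add: algebra_simps)
  hence "q powi (2 * k * k - k) = T k ^ 4 * q powi k"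
    unfolding T_def t using q_nz by (simp add: power_int_add power_int_mult)
  moreover have "(- \<alpha> / a) powi k * (- \<alpha> / b) powi k * (- \<alpha> / c) powi k * (- (q * \<alpha> * a * b * c)) powi k =
      q powi k * \<alpha> powi (4 * k)"
  proof -
    have "(- \<alpha> / a) powi k * (- \<alpha> / b) powi k * (- \<alpha> / c) powi k * (- (q * \<alpha> * a * b * c)) powi k =
        (q * \<alpha> ^ 4) powi k"
      unfolding power_int_mult_distrib[symmetric] using assms by (simp add: eval_nat_numeral mult_ac)
    thus ?thesis by (simp add: power_int_mult_distrib power_int_mult)
  qed
  ultimately show ?thesis
    unfolding theta_weight_def by (simp add: eval_nat_numeral mult_ac)
qed

end

theorem theorem3p3:
  fixes m n :: nat and q \<alpha> a b c :: complex
  assumes "0 < norm q" "norm q < 1"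
    and "\<alpha> \<noteq> 0" "a \<noteq> 0" "b \<noteq> 0" "c \<noteq> 0"
    and "\<And>t. t \<in> {a, b, c} \<Longrightarrow> qpoch_inf (- (q * \<alpha> * t)) q \<noteq> 0"
    and "\<And>t. t \<in> {a, b, c} \<Longrightarrow> qpoch_inf (q * t / \<alpha>) q \<noteq> 0"
  shows "((\<lambda>k::int.
      (1 + q powi (2 * k) * \<alpha>\<^sup>2)
      * cdqinvHahn m (q powi k * \<alpha>) a b c q * cdqinvHahn n (q powi k * \<alpha>) a b c q
      * ((\<Prod>y\<leftarrow>[\<alpha> / a, \<alpha> / b, \<alpha> / c]. qpoch_int y q k)
         / (\<Prod>y\<leftarrow>[- (q * \<alpha> * a), - (q * \<alpha> * b), - (q * \<alpha> * c)]. qpoch_int y q k))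
      * q powi (k * (k - 1) div 2) * (- (q * \<alpha> * a * b * c)) powi k)
    has_sum
      ((\<Prod>y\<leftarrow>[q, - (\<alpha>\<^sup>2), - (q / \<alpha>\<^sup>2), - (q * a * b), - (q * a * c), - (q * b * c)]. qpoch_inf y q)
       / (\<Prod>y\<leftarrow>[- (q * \<alpha> * a), - (q * \<alpha> * b), - (q * \<alpha> * c), q * a / \<alpha>, q * b / \<alpha>, q * c / \<alpha>].
            qpoch_inf y q)
       * q powi (- 4 * int (n choose 2)) * (a\<^sup>2 * b\<^sup>2 * c\<^sup>2 / q) ^ n
       * (\<Prod>y\<leftarrow>[q, - 1 / (a * b), - 1 / (a * c), - 1 / (b * c)]. qpoch y q n)
       * (if m = n then 1 else 0))) UNIV"
proof -
  interpret q_lattice q \<alpha>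
    using assms by unfold_locales auto
  define D where "D t = qpoch_inf (- (q * \<alpha> * t)) q * qpoch_inf (q * t / \<alpha>) q" for t
  define F where "F k = W a b c k * poly (hahn a b c n * hahn a b c m) (z k - 1 / z k)" for k
  define Y where "Y = qpoch q q n * qpoch (- 1 / (a * b)) q n * qpoch (- 1 / (a * c)) q n * qpoch (- 1 / (b * c)) q n"
  define \<kappa> where "\<kappa> = (a\<^sup>2 * b\<^sup>2 * c\<^sup>2 / q) ^ n"
  have L_eq: "L a b c (hahn a b c n * hahn a b c m) =
      (if m = n then \<kappa> / (q ^ (n choose 2)) ^ 4 * Y * S a b c else 0)"
  proof (cases "m \<le> n")
    case True
    thus ?thesis unfolding Y_def \<kappa>_def by (rule L_hahn_hahn[OF assms(4-6)])
  next
    case False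
    hence "n \<le> m" "n \<noteq> m" by auto
    thus ?thesis using L_hahn_hahn[OF assms(4-6), of n m] by (simp add: mult.commute)
  qed
  have "(F has_sum L a b c (hahn a b c n * hahn a b c m)) UNIV"
    unfolding F_def by (rule L_has_sum)
  \<comment> \<open>Division by these products restores the denominators that W omits.\<close>
  hence sum: "((\<lambda>k. 1 / (D a * D b * D c) * F k) has_sum
      1 / (D a * D b * D c) * L a b c (hahn a b c n * hahn a b c m)) UNIV"
    by (rule has_sum_cmult_right)
  have summand: "(1 + q powi (2 * k) * \<alpha>\<^sup>2)
      * cdqinvHahn m (q powi k * \<alpha>) a b c q * cdqinvHahn n (q powi k * \<alpha>) a b c q
      * ((\<Prod>y\<leftarrow>[\<alpha> / a, \<alpha> / b, \<alpha> / c]. qpoch_int y q k)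
         / (\<Prod>y\<leftarrow>[- (q * \<alpha> * a), - (q * \<alpha> * b), - (q * \<alpha> * c)]. qpoch_int y q k))
      * q powi (k * (k - 1) div 2) * (- (q * \<alpha> * a * b * c)) powi k = 1 / (D a * D b * D c) * F k" for k
  proof -
    define T where "T = q powi (k * (k - 1) div 2)"
    have z2: "q powi (2 * k) * \<alpha>\<^sup>2 = (z k)\<^sup>2"
      by (simp add: z_def power_mult_distrib power_int_mult mult.commute[of 2])
    have quot: "qpoch_int (\<alpha> / t) q k / qpoch_int (- (q * \<alpha> * t)) q k =
        kern q t (z k) / D t * ((- \<alpha> / t) powi k * T)" if "t \<in> {a, b, c}" for t
      unfolding D_def T_def
      by (rule qpoch_int_quotient) (use that assms(4-6) assms(7,8)[OF that] in auto)
    have "((\<Prod>y\<leftarrow>[\<alpha> / a, \<alpha> / b, \<alpha> / c]. qpoch_int y q k)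
         / (\<Prod>y\<leftarrow>[- (q * \<alpha> * a), - (q * \<alpha> * b), - (q * \<alpha> * c)]. qpoch_int y q k))
      = (qpoch_int (\<alpha> / a) q k / qpoch_int (- (q * \<alpha> * a)) q k) *
        (qpoch_int (\<alpha> / b) q k / qpoch_int (- (q * \<alpha> * b)) q k) *
        (qpoch_int (\<alpha> / c) q k / qpoch_int (- (q * \<alpha> * c)) q k)"
      by (simp add: mult.assoc)
    also have "\<dots> = K a b c k / (D a * D b * D c) *
        (((- \<alpha> / a) powi k * T) * ((- \<alpha> / b) powi k * T) * ((- \<alpha> / c) powi k * T))"
      using quot[of a] quot[of b] quot[of c] by (simp add: K_def mult_ac)
    finally have ratio: "((\<Prod>y\<leftarrow>[\<alpha> / a, \<alpha> / b, \<alpha> / c]. qpoch_int y q k)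
         / (\<Prod>y\<leftarrow>[- (q * \<alpha> * a), - (q * \<alpha> * b), - (q * \<alpha> * c)]. qpoch_int y q k)) = \<dots>" .
    have hahn: "cdqinvHahn j (q powi k * \<alpha>) a b c q = poly (hahn a b c j) (z k - 1 / z k)" for j
      using poly_hahn[OF assms(4-6) z_nz, of j k] by (simp add: z_def)
    have "(1 + q powi (2 * k) * \<alpha>\<^sup>2)
      * cdqinvHahn m (q powi k * \<alpha>) a b c q * cdqinvHahn n (q powi k * \<alpha>) a b c q
      * ((\<Prod>y\<leftarrow>[\<alpha> / a, \<alpha> / b, \<alpha> / c]. qpoch_int y q k)
         / (\<Prod>y\<leftarrow>[- (q * \<alpha> * a), - (q * \<alpha> * b), - (q * \<alpha> * c)]. qpoch_int y q k))
      * T * (- (q * \<alpha> * a * b * c)) powi k =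
      (1 + (z k)\<^sup>2) * poly (hahn a b c m) (z k - 1 / z k) * poly (hahn a b c n) (z k - 1 / z k) *
       (K a b c k * (1 / (D a * D b * D c))) *
       (((- \<alpha> / a) powi k * T) * ((- \<alpha> / b) powi k * T) * ((- \<alpha> / c) powi k * T) * T * (- (q * \<alpha> * a * b * c)) powi k)"
      unfolding ratio z2 hahn divide_inverse[of _ "D a * D b * D c"] by (simp only: mult_ac mult_1_left)
    also have "((- \<alpha> / a) powi k * T) * ((- \<alpha> / b) powi k * T) * ((- \<alpha> / c) powi k * T) * T *
        (- (q * \<alpha> * a * b * c)) powi k = theta_weight q \<alpha> k"
      unfolding T_def by (rule theta_weight_eq[OF assms(4-6)])
    finally show ?thesis
      unfolding T_def F_def W_def poly_mult by (simp only: mult_ac)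
  qed
  have Q: "q powi (- 4 * int (n choose 2)) = 1 / (q ^ (n choose 2)) ^ 4"
  proof -
    have "- 4 * int (n choose 2) = - int ((n choose 2) * 4)" by simp
    thus ?thesis by (simp only: power_int_minus power_int_of_nat power_mult inverse_eq_divide)
  qed
  have total: "1 / (D a * D b * D c) * L a b c (hahn a b c n * hahn a b c m) =
      ((\<Prod>y\<leftarrow>[q, - (\<alpha>\<^sup>2), - (q / \<alpha>\<^sup>2), - (q * a * b), - (q * a * c), - (q * b * c)]. qpoch_inf y q)
       / (\<Prod>y\<leftarrow>[- (q * \<alpha> * a), - (q * \<alpha> * b), - (q * \<alpha> * c), q * a / \<alpha>, q * b / \<alpha>, q * c / \<alpha>].
            qpoch_inf y q)
       * q powi (- 4 * int (n choose 2)) * (a\<^sup>2 * b\<^sup>2 * c\<^sup>2 / q) ^ n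
       * (\<Prod>y\<leftarrow>[q, - 1 / (a * b), - 1 / (a * c), - 1 / (b * c)]. qpoch y q n)
       * (if m = n then 1 else 0))"
    unfolding L_eq S_eq_S_0[of a b c] S_0 Q \<kappa>_def[symmetric] D_def
    by (simp add: Y_def mult_ac)
  show ?thesis
    using sum unfolding summand total .
qed

end
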